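(* Let $d\ge1$, let $\mu$ be Lebesgue measure restricted to $[-1,1]^d$ (the orthogonality measure of the multiple Legendre polynomials on the cube), and let $(\Omega_n)_n$, $(\alpha_{\cdot|n})_n$ be its Jacobi sequences. For all $n\in\mathbb{N}$ and $\overline{i}_n=cl\big((i_1,\dots,i_n)\big)$, $\overline{j}_n=cl\big((j_1,\dots,j_n)\big)\in\mathcal{A}_n$, put $n_l=\sharp\{k\in\{1,\dots,n\}: i_k=l\}$ for $1\le l\le d$, $\overline{n}=(n_1,\dots,n_d)$ and $\overline n!=n_1!\cdots n_d!$. Then $\alpha_{\cdot|n}\equiv0$, and the coefficients $\lambda_{\overline{i}_n,\overline{j}_n}$ of $\Omega_n$ in the basis $(e_{\overline{i}_n})_{\overline{i}_n\in\mathcal{A}_n}$ of $(\mathbb{C}^d)^{\hat\otimes n}$ are given by $$\lambda_{\overline{i}_n,\overline{j}_n}=\delta_{\overline{i}_n,\overline{j}_n}\frac{2^{d}}{\overline{n}!}\prod_{i=1}^d\Big(\prod_{p=0}^{n_i-1}\frac{p+1}{2p+1}\Big)^2\prod_{j=1}^d\frac{\Gamma(n_j+1)}{2n_j+1},$$ where empty products (occurring when $n_i=0$) equal $1$.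
   Context: $\mathbb{N}=\{0,1,2,\dots\}$. Let $\mathcal{P}=\mathbb{C}[X_1,\dots,X_d]$, and let $\mathcal{P}_{n]}$ be the polynomials of degree at most $n$, $\mathcal{P}_{-1]}=\{0\}$. Let $\langle P,Q\rangle_\mu=\int\overline{P}\,Q\,d\mu$. Let $\mathcal{P}_n$ be the $\langle\cdot,\cdot\rangle_\mu$-orthogonal complement of $\mathcal{P}_{n-1]}$ in $\mathcal{P}_{n]}$, and $P_n:\mathcal{P}\to\mathcal{P}_n$ the orthogonal projection. For $v=(v_1,\dots,v_d)\in\mathbb{C}^d$ let $X_v=\sum_j v_jX_j$ (multiplication operator), $a^+_v=\sum_n P_{n+1}X_vP_n$ on $\mathcal{P}$, and $a^0_{v|n}=P_nX_vP_n|_{\mathcal{P}_n}:\mathcal{P}_n\to\mathcal{P}_n$. $(\mathbb{C}^d)^{\hat\otimes n}$ is the space of symmetric tensors of order $n$, $v_n\hat\otimes\cdots\hat\otimes v_1$ is the symmetrization of $v_n\otimes\cdots\otimes v_1$, and the tensor scalar product satisfies $\langle u^{\otimes n},v^{\otimes n}\rangle=\langle u,v\rangle_{\mathbb{C}^d}^n$ with the standard scalar product on $\mathbb{C}^d$. The linear isomorphism $U_n:(\mathbb{C}^d)^{\hat\otimes n}\to\mathcal{P}_n$ is given by $U_n(v_n\hat\otimes\cdots\hat\otimes v_1)=a^+_{v_n}\cdots a^+_{v_1}1$, $U_0(z)=z\cdot1$. The Jacobi sequences are: $\Omega_n$, the linear operator on $(\mathbb{C}^d)^{\hat\otimes n}$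 with $\langle\xi,\Omega_n\eta\rangle_{(\mathbb{C}^d)^{\hat\otimes n}}=\langle U_n\xi,U_n\eta\rangle_\mu$; and $\alpha_{v|n}=U_n^{-1}a^0_{v|n}U_n$, $v\in\mathbb{C}^d$. Let $(e_1,\dots,e_d)$ be the canonical basis of $\mathbb{C}^d$. Two tuples in $\{1,\dots,d\}^n$ are equivalent if every $l\in\{1,\dots,d\}$ occurs the same number of times in both; $cl(\cdot)$ denotes the equivalence class and $\mathcal{A}_n$ the set of classes. For $\overline{j}_n=cl((j_1,\dots,j_n))$ put $e_{\overline{j}_n}=e_{j_1}\hat\otimes\cdots\hat\otimes e_{j_n}$. The coefficients of $\Omega_n$ in this basis mean $\lambda_{\overline{i}_n,\overline{j}_n}=\langle e_{\overline{i}_n},\Omega_n e_{\overline{j}_n}\rangle_{(\mathbb{C}^d)^{\hat\otimes n}}$. $\delta$ is the Kronecker symbol and $\Gamma$ the Gamma function. *)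

theory Defs
  imports "HOL-Analysis.Analysis" "HOL-Library.Poly_Mapping" "HOL-Combinatorics.Permutations"
begin

(* The index type 'd stands for {1,...,d}, so d = CARD('d) >= 1.
   Formal polynomials in C[X_1,...,X_d] are finitely supported functions from
   exponent vectors to coefficients; the product is convolution. *)
type_synonym 'd cpoly = "('d \<Rightarrow>\<^sub>0 nat) \<Rightarrow>\<^sub>0 complex"

(* Tensors over C^d, given by their coordinates in the canonical basis
   e_{k_1} \<otimes> ... \<otimes> e_{k_n}, which is indexed by the words [k_1, ..., k_n]. *)
type_synonym 'd tensor = "'d list \<Rightarrow>\<^sub>0 complex"

definition scale :: "complex \<Rightarrow> ('k \<Rightarrow>\<^sub>0 complex) \<Rightarrow> ('k \<Rightarrow>\<^sub>0 complex)"
  where "scale c p = Poly_Mapping.map ((*) c) p"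

definition clinear_on ::
    "('k \<Rightarrow>\<^sub>0 complex) set \<Rightarrow> (('k \<Rightarrow>\<^sub>0 complex) \<Rightarrow> ('m \<Rightarrow>\<^sub>0 complex)) \<Rightarrow> bool"
  where "clinear_on S f \<longleftrightarrow>
    (\<forall>s\<in>S. \<forall>t\<in>S. f (s + t) = f s + f t) \<and> (\<forall>c. \<forall>s\<in>S. f (scale c s) = scale c (f s))"


definition poly_eval :: "('d::finite) cpoly \<Rightarrow> real ^ 'd \<Rightarrow> complex"
  where "poly_eval p x = (\<Sum>m\<in>Poly_Mapping.keys p.
    Poly_Mapping.lookup p m * (\<Prod>i\<in>UNIV. complex_of_real (x $ i) ^ Poly_Mapping.lookup m i))"

(* The bound is an integer so that polys_upto (-1) = {0}. *)
definition polys_upto :: "int \<Rightarrow> ('d::finite) cpoly set"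
  where "polys_upto n =
    {p. \<forall>m\<in>Poly_Mapping.keys p. int (\<Sum>i\<in>UNIV. Poly_Mapping.lookup m i) \<le> n}"

definition poly_inner :: "(real ^ 'd) measure \<Rightarrow> ('d::finite) cpoly \<Rightarrow> 'd cpoly \<Rightarrow> complex"
  where "poly_inner \<mu> p q = (\<integral>x. cnj (poly_eval p x) * poly_eval q x \<partial>\<mu>)"

definition orth_polys :: "(real ^ 'd) measure \<Rightarrow> nat \<Rightarrow> ('d::finite) cpoly set"
  where "orth_polys \<mu> n =
    {p \<in> polys_upto (int n). \<forall>q\<in>polys_upto (int n - 1). poly_inner \<mu> q p = 0}"

definition orth_proj :: "(real ^ 'd) measure \<Rightarrow> nat \<Rightarrow> ('d::finite) cpoly \<Rightarrow> 'd cpoly"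
  where "orth_proj \<mu> n p =
    (THE q. q \<in> orth_polys \<mu> n \<and> (\<forall>r\<in>orth_polys \<mu> n. poly_inner \<mu> r (p - q) = 0))"

definition X_vec :: "complex ^ 'd \<Rightarrow> ('d::finite) cpoly"
  where "X_vec v =
    (\<Sum>j\<in>UNIV. Poly_Mapping.single (Poly_Mapping.single j 1) (v $ j))"

(* Sum_any is the sum over all n of a family with finitely many nonzero terms:
   P_n p = 0 for n beyond the degree of p. *)
definition a_plus :: "(real ^ 'd) measure \<Rightarrow> complex ^ 'd \<Rightarrow> ('d::finite) cpoly \<Rightarrow> 'd cpoly"
  where "a_plus \<mu> v p = Sum_any (\<lambda>n. orth_proj \<mu> (Suc n) (X_vec v * orth_proj \<mu> n p))"

definition a_zero ::
    "(real ^ 'd) measure \<Rightarrow> nat \<Rightarrow> complex ^ 'd \<Rightarrow> ('d::finite) cpoly \<Rightarrow> 'd cpoly"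
  where "a_zero \<mu> n v p = orth_proj \<mu> n (X_vec v * orth_proj \<mu> n p)"


definition sym_tensors :: "nat \<Rightarrow> ('d::finite) tensor set"
  where "sym_tensors n = {t. (\<forall>w\<in>Poly_Mapping.keys t. length w = n) \<and>
    (\<forall>w \<pi>. length w = n \<and> \<pi> permutes {..<n} \<longrightarrow>
      Poly_Mapping.lookup t (permute_list \<pi> w) = Poly_Mapping.lookup t w)}"

definition tensor_prod :: "(complex ^ 'd) list \<Rightarrow> ('d::finite) tensor"
  where "tensor_prod vs = (\<Sum>w | length w = length vs.
    Poly_Mapping.single w (\<Prod>k<length vs. (vs ! k) $ (w ! k)))"

definition sym_prod :: "(complex ^ 'd) list \<Rightarrow> ('d::finite) tensor"
  where "sym_prod vs = scale (1 / fact (length vs))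
    (\<Sum>\<pi> | \<pi> permutes {..<length vs}. tensor_prod (permute_list \<pi> vs))"

definition tensor_inner :: "nat \<Rightarrow> ('d::finite) tensor \<Rightarrow> 'd tensor \<Rightarrow> complex"
  where "tensor_inner n s t =
    (\<Sum>w | length w = n. cnj (Poly_Mapping.lookup s w) * Poly_Mapping.lookup t w)"


(* The list vs = [v_n, ..., v_1] is sent to a_plus v_n (... (a_plus v_1 1)).
   In U_iso and Omega the choice operator only leaves the values outside
   sym_tensors n undetermined. *)
definition U_iso :: "(real ^ 'd) measure \<Rightarrow> nat \<Rightarrow> ('d::finite) tensor \<Rightarrow> 'd cpoly"
  where "U_iso \<mu> n = (SOME U.
    bij_betw U (sym_tensors n) (orth_polys \<mu> n) \<and> clinear_on (sym_tensors n) U \<and>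
    (\<forall>vs. length vs = n \<longrightarrow> U (sym_prod vs) = foldr (a_plus \<mu>) vs 1))"

definition Omega :: "(real ^ 'd) measure \<Rightarrow> nat \<Rightarrow> ('d::finite) tensor \<Rightarrow> 'd tensor"
  where "Omega \<mu> n = (SOME \<Omega>.
    \<Omega> ` sym_tensors n \<subseteq> sym_tensors n \<and> clinear_on (sym_tensors n) \<Omega> \<and>
    (\<forall>\<xi>\<in>sym_tensors n. \<forall>\<eta>\<in>sym_tensors n.
      tensor_inner n \<xi> (\<Omega> \<eta>) = poly_inner \<mu> (U_iso \<mu> n \<xi>) (U_iso \<mu> n \<eta>)))"

definition alpha ::
    "(real ^ 'd) measure \<Rightarrow> nat \<Rightarrow> complex ^ 'd \<Rightarrow> ('d::finite) tensor \<Rightarrow> 'd tensor"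
  where "alpha \<mu> n v \<xi> =
    inv_into (sym_tensors n) (U_iso \<mu> n) (a_zero \<mu> n v (U_iso \<mu> n \<xi>))"


definition cl :: "'d list \<Rightarrow> 'd list set"
  where "cl i = {j. length j = length i \<and> (\<forall>l. count_list j l = count_list i l)}"

definition e_class :: "('d::finite) list set \<Rightarrow> 'd tensor"
  where "e_class J = (THE t. \<exists>j\<in>J. t = sym_prod (map (\<lambda>l. axis l 1) j))"

definition Omega_coeff ::
    "(real ^ 'd) measure \<Rightarrow> nat \<Rightarrow> ('d::finite) list set \<Rightarrow> 'd list set \<Rightarrow> complex"
  where "Omega_coeff \<mu> n I J = tensor_inner n (e_class I) (Omega \<mu> n (e_class J))"

end

theory Submission imports Defs begin

text \<open>
  Everything is read off from one orthogonal basis. For an exponent vector $m$ let $M_m$ be the product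
  over the coordinates $j$ of the monic Legendre polynomials $L_{m_j}(X_j)$. Lebesgue measure on the
  cube is a product measure, so the $M_m$ are orthogonal and the squared norm of $M_m$ is the product of
  the squared norms of the $L_{m_j}$ (\<open>poly_inner_multi_legendre\<close>). By symmetry of the interval the
  three-term recurrence of the Legendre polynomials has no middle term, $x L_n = L_{n+1} + c_n L_{n-1}$,
  hence $X_j M_m = M_{m+e_j} + c_{m_j} M_{m-e_j}$.

  The recurrence gives both claims. The product $X_v M_m$ has no component of degree $|m|$, so
  $a^0_v = 0$ and $\alpha = 0$. Its component of degree $|m|+1$ is $\sum_j v_j M_{m+e_j}$, so that
  $a^+_{e_{j_n}} \cdots a^+_{e_{j_1}} 1$ is $M_m$, where $m_l$ counts the occurrences of the letter $l$ in
  $(j_1, \dots, j_n)$. Thus $U_n$ sends the basis vector of a class to the orthogonal polynomial of its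
  letter counts, and the matrix of $\Omega_n$ is diagonal with the squared norms of these polynomials as
  entries (\<open>Omega_coeff_eq\<close>). In the stated formula the factorials cancel the values of the Gamma
  function, and what remains is the product of the one-variable squared norms.

  This part of the argument rests on orthogonality and on the recurrence alone, and is carried out in
  the locale \<open>recurrent_basis\<close>. Since $U_n$ and $\Omega_n$ are introduced by a choice operator, it
  includes the construction of both (\<open>U_iso_properties\<close>, \<open>tensor_inner_Omega\<close>) and the uniqueness of
  $U_n$ on symmetric tensors (\<open>U_iso_eq_sym_iso\<close>).

  The one-variable orthogonality is derived from the recurrence: a first-order differential relation
  shows that every $L_n$ with $n > 0$ has integral zero (\<open>moment_legendre_eq_0\<close>), and the recurrence
  extends this to all pairs of different indices (\<open>moment_legendre_mult_eq_0\<close>).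
\<close>

section \<open>Monic Legendre polynomials in one variable\<close>

text \<open>Chosen so that it vanishes at 0: the recurrence below then also holds for
  $n = 0$, where the truncated index $n - 1$ is $0$ again.\<close>

definition legendre_coeff :: "nat \<Rightarrow> real"
  where "legendre_coeff n = (real n)\<^sup>2 / ((2 * real n - 1) * (2 * real n + 1))"

fun legendre :: "nat \<Rightarrow> real poly" where
  "legendre 0 = 1"
| "legendre (Suc 0) = [:0, 1:]"
| "legendre (Suc (Suc n)) =
     [:0, 1:] * legendre (Suc n) - smult (legendre_coeff (Suc n)) (legendre n)"

text \<open>The squared norm $2/(2n+1)$ of the classical Legendre polynomial, divided by the square of its
  leading coefficient $\prod_{p<n} (2p+1)/(p+1)$.\<close>

definition legendre_norm :: "nat \<Rightarrow> real"
  where "legendre_norm n = 2 / (2 * real n + 1) * (\<Prod>p<n. (real p + 1) / (2 * real p + 1))\<^sup>2"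

lemma legendre_coeff_0 [simp]: "legendre_coeff 0 = 0"
  by (simp add: legendre_coeff_def)

lemma legendre_recurrence:
  "[:0, 1:] * legendre n = legendre (Suc n) + smult (legendre_coeff n) (legendre (n - 1))"
  by (cases n) auto

lemma legendre_norm_pos: "0 < legendre_norm n"
  unfolding legendre_norm_def
  by (intro mult_pos_pos divide_pos_pos zero_less_power prod_pos) auto

lemma legendre_norm_0: "legendre_norm 0 = 2"
  by (simp add: legendre_norm_def)

lemma legendre_norm_Suc: "legendre_norm (Suc n) = legendre_coeff (Suc n) * legendre_norm n"
  by (simp add: legendre_norm_def legendre_coeff_def power_mult_distrib power_divide)
     (simp add: divide_simps power2_eq_square algebra_simps)

text \<open>The classical relation $(x^2-1) P_n' = n (x P_n - P_{n-1})$ in monic normalization. It ties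
  the family, which is defined by a recurrence alone, to the interval $[-1,1]$, at whose end points
  $x^2-1$ vanishes.\<close>

lemma legendre_structure:
  "[:-1, 0, 1:] * pderiv (legendre (Suc n)) =
     smult (real (Suc n)) ([:0, 1:] * legendre (Suc n))
     - smult ((real (Suc n))\<^sup>2 / (2 * real n + 1)) (legendre n)"
proof (induction n rule: less_induct)
  case (less n)
  consider "n = 0" | "n = 1" | k where "n = Suc (Suc k)"
    by (metis One_nat_def not0_implies_Suc)
  then show ?case
  proof cases
    case 1
    then show ?thesis by (simp add: pderiv_pCons)
  next
    case 2
    then show ?thesis
      by (simp add: pderiv_pCons legendre_coeff_def numeral_2_eq_2 pderiv_diff pderiv_smult) 
  next
    case 3
    show ?thesis
    proof (rule poly_ext)
      fix x :: real
      define a b c where "a = poly (legendre (Suc (Suc k))) x" and "b = poly (legendre (Suc k)) x"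
        and "c = poly (legendre k) x"
      define a' b' where "a' = poly (pderiv (legendre (Suc (Suc k)))) x"
        and "b' = poly (pderiv (legendre (Suc k))) x"
      define \<omega> where "\<omega> m = legendre_coeff (Suc m)" for m
      have rec: "a = x * b - \<omega> k * c"
        by (simp add: a_def b_def c_def \<omega>_def)
      have A: "(x\<^sup>2 - 1) * a' = real (Suc (Suc k)) * (x * a)
          - (real (Suc (Suc k)))\<^sup>2 / (2 * real (Suc k) + 1) * b"
        using arg_cong[OF less.IH[of "Suc k"], of "\<lambda>p. poly p x"] 3
        by (simp add: a_def b_def a'_def power2_eq_square algebra_simps del: legendre.simps of_nat_Suc)
      have B: "(x\<^sup>2 - 1) * b' = real (Suc k) * (x * b) - (real (Suc k))\<^sup>2 / (2 * real k + 1) * c"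
        using arg_cong[OF less.IH[of k], of "\<lambda>p. poly p x"] 3
        by (simp add: b_def c_def b'_def power2_eq_square algebra_simps del: legendre.simps of_nat_Suc)
      have c: "\<omega> k * c = x * b - a"
        using rec by simp
      have \<omega>k: "(real (Suc k))\<^sup>2 / (2 * real k + 1) = (2 * real k + 3) * \<omega> k"
        by (simp add: \<omega>_def legendre_coeff_def divide_simps) (simp add: algebra_simps)
      (* Eliminating c through the recurrence leaves an identity in a and b alone. *)
      have B': "(x\<^sup>2 - 1) * b' = real (Suc k) * (x * b) - (2 * real k + 3) * (x * b - a)"
        using B unfolding \<omega>k mult.assoc c .
      have "(x\<^sup>2 - 1) * (a + x * a' - \<omega> (Suc k) * b')
          = (x\<^sup>2 - 1) * a + x * ((x\<^sup>2 - 1) * a') - \<omega> (Suc k) * ((x\<^sup>2 - 1) * b')"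
        by (simp add: algebra_simps)
      also have "\<dots> = (real k + 3) * (x * (x * a - \<omega> (Suc k) * b))
          - (real k + 3)\<^sup>2 / (2 * real k + 5) * a"
        unfolding A B' \<omega>_def legendre_coeff_def
        by (simp add: divide_simps) (simp add: algebra_simps power2_eq_square)
      finally show "poly ([:-1, 0, 1:] * pderiv (legendre (Suc n))) x =
        poly (smult (real (Suc n)) ([:0, 1:] * legendre (Suc n))
          - smult ((real (Suc n))\<^sup>2 / (2 * real n + 1)) (legendre n)) x"
        unfolding 3 legendre.simps(3)[of "Suc k"]
        by (simp add: pderiv_diff pderiv_smult pderiv_mult pderiv_pCons 
              a_def [symmetric] b_def [symmetric] a'_def [symmetric] b'_def [symmetric] \<omega>_def [symmetric]
              power2_eq_square algebra_simps del: legendre.simps)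
    qed
  qed
qed

definition moment :: "real poly \<Rightarrow> real"
  where "moment p = (\<integral>x. poly p x * indicator {-1..1} x \<partial>lborel)"

lemma integrable_poly_interval:
  "integrable lborel (\<lambda>x. poly p x * indicator {-1..1::real} x)"
  by (rule borel_integrable_atLeastAtMost) auto

lemma moment_add: "moment (p + q) = moment p + moment q"
  unfolding moment_def
  by (simp add: distrib_right Bochner_Integration.integral_add integrable_poly_interval)

lemma moment_smult: "moment (smult c p) = c * moment p"
  by (simp add: moment_def mult.assoc)

lemma moment_diff: "moment (p - q) = moment p - moment q"
  using moment_add[of "p - q" q] by simp

lemma moment_pderiv: "moment (pderiv p) = poly p 1 - poly p (-1)"
  unfolding moment_def by (rule integral_FTC_Icc_real) (auto intro: poly_DERIV)

lemma moment_1: "moment 1 = 2"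
  using moment_pderiv[of "[:0, 1:]"] by (simp add: pderiv_pCons one_pCons)

text \<open>Integrating the derivative of $(x^2-1) L_{n}$ over $[-1,1]$ gives 0, and the structure relation
  turns this into a two-step recursion which expresses the integral of $L_{n+1}$ by that of $L_{n-1}$.
  Its factor vanishes for $n = 1$, which separates the even indices $n > 0$ from the nonzero integral
  of $L_0$.\<close>

lemma moment_legendre_eq_0: "0 < n \<Longrightarrow> moment (legendre n) = 0"
proof (induction n rule: less_induct)
  case (less n)
  show ?case
  proof (cases "n = 1")
    case True
    then show ?thesis
      using moment_pderiv[of "[:0, 0, 1/2:]"] by (simp add: pderiv_pCons)
  next
    case False
    then obtain k where n: "n = Suc (Suc k)"
      using less.prems by (metis One_nat_def not0_implies_Suc less_numeral_extra(3))
    let ?X = "[:0, 1:] * legendre (Suc k)"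
    let ?b = "(real (Suc k))\<^sup>2 / (2 * real k + 1)"
    have "pderiv ([:-1, 0, 1:] * legendre (Suc k)) =
        smult 2 ?X + (smult (real (Suc k)) ?X - smult ?b (legendre k))"
      by (subst pderiv_mult, subst legendre_structure)
         (simp add: pderiv_pCons del: legendre.simps of_nat_Suc)
    then have "0 = (2 + real (Suc k)) * moment ?X - ?b * moment (legendre k)"
      using moment_pderiv[of "[:-1, 0, 1:] * legendre (Suc k)"]
      by (simp add: moment_add moment_diff moment_smult distrib_right 
           del: legendre.simps mult_pCons_left mult_pCons_right of_nat_Suc)
    moreover have "moment ?X = moment (legendre n)
        + legendre_coeff (Suc k) * moment (legendre k)"
      unfolding n legendre_recurrence[of "Suc k"] by (simp add: moment_add moment_smult del: legendre.simps)
    ultimately have eq: "(3 + real k) * moment (legendre n) =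
        (?b - (3 + real k) * legendre_coeff (Suc k)) * moment (legendre k)"
      by (simp add: algebra_simps)
    have "(?b - (3 + real k) * legendre_coeff (Suc k)) * moment (legendre k) = 0"
    proof (cases "k = 0")
      case True
      (* The integral of legendre 0 is 2; here it is the other factor that vanishes. *)
      then show ?thesis by (simp add: legendre_coeff_def)
    next
      case False
      then show ?thesis using less.IH[of k] n by simp
    qed
    then have "(3 + real k) * moment (legendre n) = 0"
      unfolding eq .
    moreover have "3 + real k \<noteq> 0" by linarith
    ultimately show ?thesis by (metis mult_eq_0_iff)
  qed
qed

lemma moment_legendre_shift:
  "moment ([:0, 1:] * legendre n * legendre m) =
   moment (legendre (Suc n) * legendre m)
   + legendre_coeff n * moment (legendre (n - 1) * legendre m)"
  unfolding legendre_recurrence by (simp add: distrib_right moment_add moment_smult)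

text \<open>Favard's argument: for a family with a three-term recurrence, orthogonality follows from the
  orthogonality to the constant 1. The recurrence moves one degree from the second factor to the
  first, and the gap between the two indices never closes.\<close>

lemma moment_legendre_mult_eq_0: "m < n \<Longrightarrow> moment (legendre n * legendre m) = 0"
proof (induction m arbitrary: n rule: legendre.induct)
  case 1
  then show ?case by (simp add: moment_legendre_eq_0)
next
  case 2
  then show ?case
    using moment_legendre_shift[of n 0] by (simp add: moment_legendre_eq_0 mult.commute)
next
  case (3 m)
  have "legendre n * legendre (Suc (Suc m)) =
      [:0, 1:] * legendre n * legendre (Suc m) - smult (legendre_coeff (Suc m)) (legendre n * legendre m)"
    by (simp add: algebra_simps)
  then show ?case
    using 3 moment_legendre_shift[of n "Suc m"] by (simp add: moment_diff moment_smult del: legendre.simps mult_pCons_left)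
qed

text \<open>The factor $x$ in $x L_n$ can be moved to the other side of the integral; each side then contributes
  a single term of its recurrence.\<close>

lemma moment_legendre_square: "moment (legendre n * legendre n) = legendre_norm n"
proof (induction n)
  case 0
  then show ?case by (simp add: moment_1 legendre_norm_0)
next
  case (Suc n)
  have "moment (legendre (Suc n) * legendre (Suc n))
      = moment ([:0, 1:] * legendre n * legendre (Suc n))"
    using moment_legendre_shift[of n "Suc n"] moment_legendre_mult_eq_0[of "n - 1" "Suc n"]
    by (simp add: mult.commute del: legendre.simps mult_pCons_left mult_pCons_right)
  also have "\<dots> = moment ([:0, 1:] * legendre (Suc n) * legendre n)"
    by (simp only: ac_simps)
  also have "\<dots> = legendre_coeff (Suc n) * legendre_norm n"
    using moment_legendre_shift[of "Suc n" n] moment_legendre_mult_eq_0[of n "Suc (Suc n)"] Suc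
    by (simp del: legendre.simps mult_pCons_left mult_pCons_right)
  finally show ?case by (simp add: legendre_norm_Suc)
qed

theorem legendre_orthogonal:
  "moment (legendre n * legendre m) = (if n = m then legendre_norm n else 0)"
  using moment_legendre_mult_eq_0[of n m] moment_legendre_mult_eq_0[of m n]
  by (cases n m rule: linorder_cases) (auto simp: moment_legendre_square mult.commute)

section \<open>Formal polynomials as a complex vector space of functions\<close>

lemma lookup_scale [simp]: "Poly_Mapping.lookup (scale c p) k = c * Poly_Mapping.lookup p k"
  unfolding scale_def by transfer (simp add: when_def)

interpretation scale: vector_space "scale :: complex \<Rightarrow> ('k \<Rightarrow>\<^sub>0 complex) \<Rightarrow> ('k \<Rightarrow>\<^sub>0 complex)"
  by unfold_locales (auto intro!: poly_mapping_eqI simp: lookup_add algebra_simps)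

lemma scale_mult_right: "p * scale c q = scale c (p * q)" for p q :: "('d::finite) cpoly"
  by (simp add: scale_def Poly_Mapping.mult_map_scale_conv_mult ac_simps)

lemma scale_mult_left: "scale c p * q = scale c (p * q)" for p q :: "('d::finite) cpoly"
  by (simp add: scale_def Poly_Mapping.mult_map_scale_conv_mult ac_simps)

lemma scale_single: "scale c (Poly_Mapping.single k d) = Poly_Mapping.single k (c * d)"
  by (rule poly_mapping_eqI) (simp add: lookup_single when_def)

lemma sum_single_keys: "(\<Sum>k\<in>Poly_Mapping.keys p. Poly_Mapping.single k (Poly_Mapping.lookup p k)) = p"
  by (rule poly_mapping_eqI)
     (auto simp: lookup_sum lookup_single when_def sum.delta in_keys_iff cong: if_cong)

lemma poly_eval_superset:
  assumes "finite A" "Poly_Mapping.keys p \<subseteq> A"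
  shows "poly_eval p x = (\<Sum>m\<in>A. Poly_Mapping.lookup p m *
    (\<Prod>i\<in>UNIV. complex_of_real (x $ i) ^ Poly_Mapping.lookup m i))"
  unfolding poly_eval_def
  by (rule sum.mono_neutral_left) (use assms in \<open>auto simp: in_keys_iff\<close>)

lemma poly_eval_add: "poly_eval (p + q) x = poly_eval p x + poly_eval q x"
proof -
  let ?A = "Poly_Mapping.keys p \<union> Poly_Mapping.keys q"
  have "Poly_Mapping.keys (p + q) \<subseteq> ?A" by (rule Poly_Mapping.keys_add)
  then show ?thesis
    by (simp add: poly_eval_superset[of ?A] lookup_add distrib_right sum.distrib)
qed

lemma poly_eval_scale: "poly_eval (scale c p) x = c * poly_eval p x"
proof -
  have "Poly_Mapping.keys (scale c p) \<subseteq> Poly_Mapping.keys p"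
    by (auto simp: in_keys_iff)
  then show ?thesis
    by (simp add: poly_eval_superset[of "Poly_Mapping.keys p"] sum_distrib_left mult.assoc)
qed

lemma poly_eval_0 [simp]: "poly_eval 0 x = 0"
  by (simp add: poly_eval_def)

lemma poly_eval_sum: "poly_eval (sum f A) x = (\<Sum>a\<in>A. poly_eval (f a) x)"
  by (induction A rule: infinite_finite_induct) (auto simp: poly_eval_add)

lemma poly_eval_diff: "poly_eval (p - q) x = poly_eval p x - poly_eval q x"
  using poly_eval_add[of "p - q" q x] by simp

lemma poly_eval_single:
  "poly_eval (Poly_Mapping.single m c) x =
   c * (\<Prod>i\<in>UNIV. complex_of_real (x $ i) ^ Poly_Mapping.lookup m i)"
  by (subst poly_eval_superset[of "{m}"]) auto

text \<open>Evaluation respects the convolution product because it does so on monomials.\<close>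

lemma poly_eval_mult: "poly_eval (p * q) x = poly_eval p x * poly_eval q x"
proof -
  let ?s = "\<lambda>p k. Poly_Mapping.single k (Poly_Mapping.lookup p k)"
  have "p * q = (\<Sum>k\<in>Poly_Mapping.keys p. ?s p k) * (\<Sum>l\<in>Poly_Mapping.keys q. ?s q l)"
    by (simp only: sum_single_keys)
  also have "poly_eval \<dots> x =
      (\<Sum>k\<in>Poly_Mapping.keys p. \<Sum>l\<in>Poly_Mapping.keys q. poly_eval (?s p k) x * poly_eval (?s q l) x)"
    by (simp add: sum_product poly_eval_sum mult_single poly_eval_single lookup_add power_add
        prod.distrib ac_simps)
  also have "\<dots> = poly_eval (\<Sum>k\<in>Poly_Mapping.keys p. ?s p k) x
      * poly_eval (\<Sum>l\<in>Poly_Mapping.keys q. ?s q l) x"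
    by (simp add: sum_product poly_eval_sum)
  finally show ?thesis by (simp only: sum_single_keys)
qed

lemma poly_eval_1 [simp]: "poly_eval 1 x = 1"
  using poly_eval_single[of 0 1 x] by simp

lemma poly_eval_prod: "poly_eval (prod f A) x = (\<Prod>a\<in>A. poly_eval (f a) x)"
  by (induction A rule: infinite_finite_induct) (auto simp: poly_eval_mult)

definition var :: "'d \<Rightarrow> ('d::finite) cpoly"
  where "var j = Poly_Mapping.single (Poly_Mapping.single j 1) 1"

lemma poly_eval_var [simp]: "poly_eval (var j) x = complex_of_real (x $ j)"
proof -
  have "(\<Prod>i\<in>UNIV. complex_of_real (x $ i) ^ (1 when j = i)) = (\<Prod>i\<in>{j}. complex_of_real (x $ i))"
    by (rule prod.mono_neutral_cong_right) auto
  then show ?thesis by (simp add: var_def poly_eval_single lookup_single)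
qed

lemma X_vec_eq: "X_vec v = (\<Sum>j\<in>UNIV. scale (v $ j) (var j))"
  by (simp add: X_vec_def var_def scale_single)

section \<open>Polynomials of bounded degree\<close>

lemma polys_upto_add: "p \<in> polys_upto n \<Longrightarrow> q \<in> polys_upto n \<Longrightarrow> p + q \<in> polys_upto n"
  using Poly_Mapping.keys_add[of p q] unfolding polys_upto_def by blast

lemma polys_upto_scale: "p \<in> polys_upto n \<Longrightarrow> scale c p \<in> polys_upto n"
  unfolding polys_upto_def by (auto simp: in_keys_iff)

lemma polys_upto_0 [simp]: "0 \<in> polys_upto n"
  by (simp add: polys_upto_def)

lemma polys_upto_diff: "p \<in> polys_upto n \<Longrightarrow> q \<in> polys_upto n \<Longrightarrow> p - q \<in> polys_upto n"
  unfolding polys_upto_def by (auto simp: in_keys_iff lookup_minus)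

lemma polys_upto_sum: "(\<And>a. a \<in> A \<Longrightarrow> f a \<in> polys_upto n) \<Longrightarrow> sum f A \<in> polys_upto n"
  by (induction A rule: infinite_finite_induct) (auto intro: polys_upto_add)

lemma polys_upto_mono: "p \<in> polys_upto m \<Longrightarrow> m \<le> n \<Longrightarrow> p \<in> polys_upto n"
  unfolding polys_upto_def by force

lemma sum_lookup_single: "(\<Sum>i\<in>UNIV. Poly_Mapping.lookup (Poly_Mapping.single j c) i) = c"
  for j :: "'d::finite"
  by (simp add: lookup_single when_def)

lemma polys_upto_var_mult:
  assumes "p \<in> polys_upto n"
  shows "var j * p \<in> polys_upto (n + 1)"
proof -
  have "int (\<Sum>i\<in>UNIV. Poly_Mapping.lookup k i) \<le> n + 1" if k: "k \<in> Poly_Mapping.keys (var j * p)" for k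
  proof -
    obtain l where "k = Poly_Mapping.single j 1 + l" "l \<in> Poly_Mapping.keys p"
      using subsetD[OF Poly_Mapping.keys_mult[of "var j" p] k] unfolding var_def by auto
    then show ?thesis
      using assms by (simp add: polys_upto_def lookup_add sum.distrib sum_lookup_single)
  qed
  then show ?thesis by (simp add: polys_upto_def)
qed

lemma polys_upto_negative:
  assumes "n < 0" "p \<in> polys_upto n"
  shows "p = 0"
proof (rule ccontr)
  assume "p \<noteq> 0"
  then obtain k where "k \<in> Poly_Mapping.keys p" by (metis keys_eq_empty ex_in_conv)
  then have "int (\<Sum>i\<in>UNIV. Poly_Mapping.lookup k i) \<le> n" using assms(2) by (simp add: polys_upto_def)
  then show False using assms(1) by linarith
qed

section \<open>Measures whose orthogonal polynomials satisfy a coordinatewise recurrence\<close>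

definition deg :: "('d::finite \<Rightarrow> nat) \<Rightarrow> nat"
  where "deg m = sum m UNIV"

definition inc :: "'d \<Rightarrow> ('d \<Rightarrow> nat) \<Rightarrow> 'd \<Rightarrow> nat"
  where "inc j m = m(j := Suc (m j))"

text \<open>Truncated, so that \<open>dec j m = m\<close> if \<open>m j = 0\<close>.\<close>

definition dec :: "'d \<Rightarrow> ('d \<Rightarrow> nat) \<Rightarrow> 'd \<Rightarrow> nat"
  where "dec j m = m(j := m j - 1)"

lemma deg_inc [simp]: "deg (inc j m) = Suc (deg m)"
proof -
  have "deg (inc j m) = Suc (m j) + sum m (UNIV - {j})"
    unfolding deg_def by (subst sum.remove[of _ j]) (auto simp: inc_def)
  also have "\<dots> = Suc (deg m)"
    unfolding deg_def by (subst (2) sum.remove[of _ j]) auto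
  finally show ?thesis .
qed

lemma inc_dec [simp]: "0 < m j \<Longrightarrow> inc j (dec j m) = m"
  by (simp add: inc_def dec_def)

lemma deg_dec: "0 < m j \<Longrightarrow> Suc (deg (dec j m)) = deg m"
  by (metis inc_dec deg_inc)

lemma deg_zero [simp]: "deg (\<lambda>_. 0) = 0"
  by (simp add: deg_def)

lemma finite_deg_le [simp]: "finite {m :: 'd::finite \<Rightarrow> nat. deg m \<le> n}"
proof (rule finite_subset)
  show "{m :: 'd \<Rightarrow> nat. deg m \<le> n} \<subseteq> PiE UNIV (\<lambda>_. {..n})"
  proof
    fix m :: "'d \<Rightarrow> nat" assume "m \<in> {m. deg m \<le> n}"
    moreover have "m i \<le> deg m" for i unfolding deg_def by (rule member_le_sum) auto
    ultimately have "m i \<le> n" for i by (metis mem_Collect_eq order.trans)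
    then show "m \<in> PiE UNIV (\<lambda>_. {..n})" by (simp add: PiE_UNIV_domain)
  qed
qed (auto intro: finite_PiE)

lemma finite_deg_eq [simp]: "finite {m :: 'd::finite \<Rightarrow> nat. deg m = n}"
  by (rule finite_subset[OF _ finite_deg_le[of n]]) auto

text \<open>What the argument takes from the multiple Legendre polynomials. Positive squared norms make the
  inner product definite, so that coefficients in the basis determine a polynomial. Multiplication by
  a variable changes the degree by exactly one, which makes the preservation operators vanish. The
  condition on \<open>\<omega>\<close> discards the meaningless lower term in directions in which the degree is already 0.\<close>

locale recurrent_basis =
  fixes \<mu> :: "(real ^ 'd::finite) measure"
    and M :: "('d \<Rightarrow> nat) \<Rightarrow> 'd cpoly"
    and N :: "('d \<Rightarrow> nat) \<Rightarrow> real"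
    and \<omega> :: "('d \<Rightarrow> nat) \<Rightarrow> 'd \<Rightarrow> complex"
  assumes integrable_inner: "integrable \<mu> (\<lambda>x. cnj (poly_eval p x) * poly_eval q x)"
    and inner_M: "poly_inner \<mu> (M m) (M m') = (if m = m' then complex_of_real (N m) else 0)"
    and N_pos: "0 < N m"
    and M_0: "M (\<lambda>_. 0) = 1"
    and var_M: "var j * M m = M (inc j m) + scale (\<omega> m j) (M (dec j m))"
    and \<omega>_0: "m j = 0 \<Longrightarrow> \<omega> m j = 0"
begin

subsection \<open>Expansion in the basis\<close>

lemma inner_add_right: "poly_inner \<mu> p (q + r) = poly_inner \<mu> p q + poly_inner \<mu> p r"
  by (simp add: poly_inner_def poly_eval_add distrib_left integrable_inner)

lemma inner_scale_right: "poly_inner \<mu> p (scale c q) = c * poly_inner \<mu> p q"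
  by (simp add: poly_inner_def poly_eval_scale mult.left_commute[of _ c])

lemma inner_0_right [simp]: "poly_inner \<mu> p 0 = 0"
  by (simp add: poly_inner_def)

lemma inner_sum_right: "poly_inner \<mu> p (sum f A) = (\<Sum>a\<in>A. poly_inner \<mu> p (f a))"
  by (induction A rule: infinite_finite_induct) (auto simp: inner_add_right)

lemma inner_diff_right: "poly_inner \<mu> p (q - r) = poly_inner \<mu> p q - poly_inner \<mu> p r"
  using inner_add_right[of p "q - r" r] by simp

lemma inner_commute: "poly_inner \<mu> p q = cnj (poly_inner \<mu> q p)"
proof -
  have "cnj (poly_inner \<mu> q p) = (\<integral>x. cnj (cnj (poly_eval q x) * poly_eval p x) \<partial>\<mu>)"
    unfolding poly_inner_def by (rule Bochner_Integration.integral_cnj[symmetric])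
  then show ?thesis by (simp add: poly_inner_def mult.commute)
qed

lemma inner_scale_left: "poly_inner \<mu> (scale c p) q = cnj c * poly_inner \<mu> p q"
  by (metis inner_commute inner_scale_right complex_cnj_mult)

lemma inner_sum_left: "poly_inner \<mu> (sum f A) p = (\<Sum>a\<in>A. poly_inner \<mu> (f a) p)"
proof -
  have "poly_inner \<mu> (sum f A) p = (\<Sum>a\<in>A. cnj (poly_inner \<mu> p (f a)))"
    unfolding inner_commute[of "sum f A"] inner_sum_right cnj_sum ..
  then show ?thesis unfolding inner_commute[of _ p, symmetric] .
qed

definition coef :: "('d \<Rightarrow> nat) \<Rightarrow> 'd cpoly \<Rightarrow> complex"
  where "coef m p = poly_inner \<mu> (M m) p / complex_of_real (N m)"

lemma N_neq_0 [simp]: "N m \<noteq> 0"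
  using N_pos[of m] by simp

lemma inner_M_left: "poly_inner \<mu> (M m) p = complex_of_real (N m) * coef m p"
  by (simp add: coef_def)

lemma coef_linear:
  "coef m 0 = 0" "coef m (p + q) = coef m p + coef m q" "coef m (p - q) = coef m p - coef m q"
  "coef m (scale c p) = c * coef m p" "coef m (sum f A) = (\<Sum>a\<in>A. coef m (f a))"
  by (simp_all add: coef_def inner_add_right inner_diff_right inner_scale_right inner_sum_right
      add_divide_distrib diff_divide_distrib sum_divide_distrib)

lemma coef_M: "coef m (M m') = (if m = m' then 1 else 0)"
  by (simp add: coef_def inner_M)

lemma coef_combination:
  "finite A \<Longrightarrow> coef m (\<Sum>a\<in>A. scale (f a) (M a)) = (if m \<in> A then f m else 0)"
  by (simp add: coef_linear coef_M if_distrib[of "\<lambda>x. _ * x"] cong: if_cong)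

text \<open>The polynomials that are the sum of their Fourier series over \<open>A\<close>. For finite \<open>A\<close> this is the
  linear span of the \<open>M m\<close> with \<open>m \<in> A\<close>.\<close>

definition expands :: "('d \<Rightarrow> nat) set \<Rightarrow> 'd cpoly \<Rightarrow> bool"
  where "expands A p \<longleftrightarrow> (\<Sum>m\<in>A. scale (coef m p) (M m)) = p"

lemma expands_M: "finite A \<Longrightarrow> m \<in> A \<Longrightarrow> expands A (M m)"
  by (simp add: expands_def coef_M if_distrib[of "\<lambda>c. scale c _"] cong: if_cong)

lemma expands_add: "expands A p \<Longrightarrow> expands A q \<Longrightarrow> expands A (p + q)"
  by (simp add: expands_def coef_linear scale.scale_left_distrib sum.distrib)

lemma expands_scale: "expands A p \<Longrightarrow> expands A (scale c p)"
  by (simp add: expands_def coef_linear flip: scale.scale_scale scale.scale_sum_right)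

lemma expands_sum: "(\<And>i. i \<in> I \<Longrightarrow> expands A (f i)) \<Longrightarrow> expands A (sum f I)"
  by (induction I rule: infinite_finite_induct)
     (auto intro: expands_add simp: expands_def[of A 0] coef_linear)

lemma expands_mono:
  assumes "expands A p" "A \<subseteq> B" "finite B"
  shows "expands B p"
proof -
  have "expands B (\<Sum>m\<in>A. scale (coef m p) (M m))"
    using assms(2,3) by (intro expands_sum expands_scale expands_M) auto
  then show ?thesis using assms(1) by (simp add: expands_def[of A])
qed

lemma expands_var_mult:
  assumes "expands {m. deg m \<le> n} p"
  shows "expands {m. deg m \<le> Suc n} (var j * p)"
proof -
  have *: "expands {m. deg m \<le> Suc n} (var j * M m)" if "deg m \<le> n" for m
  proof -
    have "expands {m. deg m \<le> Suc n} (scale (\<omega> m j) (M (dec j m)))"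
    proof (cases "m j = 0")
      case True
      then show ?thesis by (simp add: \<omega>_0 expands_def coef_linear)
    next
      case False
      then show ?thesis using deg_dec[of m j] that by (intro expands_scale expands_M) auto
    qed
    then show ?thesis
      unfolding var_M using that by (intro expands_add expands_M) auto
  qed
  have "var j * p = var j * (\<Sum>m | deg m \<le> n. scale (coef m p) (M m))"
    using assms unfolding expands_def by (rule arg_cong[OF sym])
  also have "\<dots> = (\<Sum>m | deg m \<le> n. scale (coef m p) (var j * M m))"
    by (simp add: sum_distrib_left scale_mult_right)
  finally have "var j * p = (\<Sum>m | deg m \<le> n. scale (coef m p) (var j * M m))" .
  then show ?thesis using * by (auto intro!: expands_sum expands_scale)
qed

text \<open>Every monomial arises from 1 by multiplications with variables, and these preserve the span of the
  basis at the cost of one degree.\<close>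

lemma expands_monomial:
  "deg (Poly_Mapping.lookup k) = n \<Longrightarrow> expands {m. deg m \<le> n} (Poly_Mapping.single k 1)"
proof (induction n arbitrary: k)
  case 0
  then have "k = 0" by (auto intro: poly_mapping_eqI simp: deg_def)
  then show ?case using expands_M[of "{m. deg m \<le> 0}" "\<lambda>_. 0"] finite_deg_le[of 0] by (simp add: M_0)
next
  case (Suc n)
  then obtain j where j: "Poly_Mapping.lookup k j \<noteq> 0"
    unfolding deg_def by (metis nat.distinct(1) sum.neutral)
  define k' where "k' = k - Poly_Mapping.single j 1"
  have k: "k = Poly_Mapping.single j 1 + k'"
    unfolding k'_def using j
    by (intro poly_mapping_eqI) (auto simp: lookup_add lookup_minus lookup_single when_def)
  have "deg (Poly_Mapping.lookup k') = n"
    using Suc.prems unfolding deg_def k lookup_add sum.distrib sum_lookup_single by simp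
  then have "expands {m. deg m \<le> Suc n} (var j * Poly_Mapping.single k' 1)"
    by (intro expands_var_mult Suc.IH)
  moreover have "var j * Poly_Mapping.single k' 1 = Poly_Mapping.single k 1"
    unfolding var_def mult_single k by simp
  ultimately show ?case by simp
qed

lemma expands_polys_upto:
  assumes "p \<in> polys_upto (int n)"
  shows "expands {m. deg m \<le> n} p"
proof -
  have "expands {m. deg m \<le> n} (\<Sum>k\<in>Poly_Mapping.keys p. scale (Poly_Mapping.lookup p k) (Poly_Mapping.single k 1))"
  proof (intro expands_sum expands_scale)
    fix k assume "k \<in> Poly_Mapping.keys p"
    then have "deg (Poly_Mapping.lookup k) \<le> n"
      using assms by (simp add: polys_upto_def deg_def flip: of_nat_sum)
    then show "expands {m. deg m \<le> n} (Poly_Mapping.single k 1)"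
      by (intro expands_mono[OF expands_monomial[OF refl]]) auto
  qed
  then show ?thesis by (simp add: scale_single sum_single_keys)
qed

text \<open>The recurrence, solved for its leading term, builds \<open>M m\<close> from basis elements of smaller degree.\<close>

lemma M_polys_upto: "M m \<in> polys_upto (int (deg m))"
proof (induction "deg m" arbitrary: m rule: less_induct)
  case less
  show ?case
  proof (cases "\<exists>j. 0 < m j")
    case False
    then have "m = (\<lambda>_. 0)" by auto
    then show ?thesis by (simp add: M_0 polys_upto_def)
  next
    case True
    then obtain j where j: "0 < m j" by blast
    define m' where "m' = dec j m"
    have m: "m = inc j m'" "deg m = Suc (deg m')"
      using j deg_dec[of m j] by (auto simp: m'_def)
    have "M m = var j * M m' - scale (\<omega> m' j) (M (dec j m'))"
      unfolding var_M m by simp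
    moreover have "var j * M m' \<in> polys_upto (int (deg m))"
      using polys_upto_var_mult[OF less[of m']] m by (simp add: add.commute)
    moreover have "scale (\<omega> m' j) (M (dec j m')) \<in> polys_upto (int (deg m))"
    proof (cases "m' j = 0")
      case True
      then show ?thesis by (simp add: \<omega>_0)
    next
      case False
      then have "deg (dec j m') < deg m" using deg_dec[of m' j] m by simp
      then show ?thesis using less[of "dec j m'"] by (intro polys_upto_scale) (auto intro: polys_upto_mono)
    qed
    ultimately show ?thesis by (auto intro: polys_upto_diff)
  qed
qed

subsection \<open>Orthogonal polynomials of a fixed degree\<close>

text \<open>The explicit form of the orthogonal projection onto the orthogonal polynomials of degree \<open>n\<close>.\<close>

definition level_proj :: "nat \<Rightarrow> 'd cpoly \<Rightarrow> 'd cpoly"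
  where "level_proj n p = (\<Sum>m | deg m = n. scale (coef m p) (M m))"

lemma coef_level_proj: "coef m (level_proj n p) = (if deg m = n then coef m p else 0)"
  by (simp add: level_proj_def coef_combination)

lemma M_orth_polys: "M m \<in> orth_polys \<mu> (deg m)"
proof -
  have "poly_inner \<mu> q (M m) = 0" if q: "q \<in> polys_upto (int (deg m) - 1)" for q
  proof (cases "deg m")
    case 0
    then have "q = 0" using q by (intro polys_upto_negative[of "int (deg m) - 1"]) auto
    then show ?thesis by (simp add: poly_inner_def)
  next
    case (Suc n)
    then have "expands {m. deg m \<le> n} q" using q by (intro expands_polys_upto) simp
    then have "poly_inner \<mu> q (M m) = poly_inner \<mu> (\<Sum>m' | deg m' \<le> n. scale (coef m' q) (M m')) (M m)"
      unfolding expands_def by simp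
    also have "\<dots> = (\<Sum>m' | deg m' \<le> n. cnj (coef m' q) * poly_inner \<mu> (M m') (M m))"
      by (simp only: inner_sum_left inner_scale_left)
    also have "\<dots> = 0" by (rule sum.neutral) (use Suc in \<open>auto simp: inner_M\<close>)
    finally show ?thesis .
  qed
  then show ?thesis by (simp add: orth_polys_def M_polys_upto)
qed

lemma orth_polys_combination:
  assumes "\<And>a. a \<in> A \<Longrightarrow> p a \<in> orth_polys \<mu> n"
  shows "(\<Sum>a\<in>A. scale (f a) (p a)) \<in> orth_polys \<mu> n"
  using assms unfolding orth_polys_def
  by (auto intro!: polys_upto_sum polys_upto_scale simp: inner_sum_right inner_scale_right)

lemma level_proj_orth_polys: "level_proj n p \<in> orth_polys \<mu> n"
  unfolding level_proj_def by (rule orth_polys_combination) (use M_orth_polys in auto)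

text \<open>Expand up to degree \<open>n\<close>: the coefficients of smaller degree are inner products with polynomials of
  smaller degree, hence vanish.\<close>

lemma level_proj_id:
  assumes "p \<in> orth_polys \<mu> n"
  shows "level_proj n p = p"
proof -
  have "p = (\<Sum>m | deg m \<le> n. scale (coef m p) (M m))"
    using assms expands_polys_upto[of p n] by (simp add: orth_polys_def expands_def)
  also have "\<dots> = (\<Sum>m | deg m = n. scale (coef m p) (M m))"
  proof (rule sum.mono_neutral_right)
    show "\<forall>m\<in>{m. deg m \<le> n} - {m. deg m = n}. scale (coef m p) (M m) = 0"
    proof
      fix m :: "'d \<Rightarrow> nat" assume "m \<in> {m. deg m \<le> n} - {m. deg m = n}"
      then have "M m \<in> polys_upto (int n - 1)"
        using M_polys_upto[of m] by (auto intro: polys_upto_mono)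
      then show "scale (coef m p) (M m) = 0" using assms by (simp add: orth_polys_def coef_def)
    qed
  qed auto
  finally show ?thesis by (simp add: level_proj_def)
qed

lemma orth_polys_eqI:
  assumes "p \<in> orth_polys \<mu> n" "q \<in> orth_polys \<mu> n" "\<And>m. deg m = n \<Longrightarrow> coef m p = coef m q"
  shows "p = q"
proof -
  have "level_proj n p = level_proj n q"
    unfolding level_proj_def using assms(3) by (auto intro: sum.cong)
  then show ?thesis using assms by (simp add: level_proj_id)
qed

lemma level_proj_unique:
  assumes "q \<in> orth_polys \<mu> n" "\<forall>r\<in>orth_polys \<mu> n. poly_inner \<mu> r (p - q) = 0"
  shows "q = level_proj n p"
proof (rule orth_polys_eqI[OF assms(1) level_proj_orth_polys])
  fix m :: "'d \<Rightarrow> nat" assume m: "deg m = n"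
  then have "poly_inner \<mu> (M m) (p - q) = 0" using assms(2) M_orth_polys[of m] by simp
  then show "coef m q = coef m (level_proj n p)"
    using m unfolding coef_level_proj by (simp add: coef_def inner_diff_right)
qed

text \<open>The projection is introduced as the unique element with an orthogonality property, so it has to be
  shown that \<open>level_proj\<close> has this property and that nothing else has it.\<close>

lemma orth_proj_eq: "orth_proj \<mu> n p = level_proj n p"
  unfolding orth_proj_def
proof (rule the_equality)
  have "poly_inner \<mu> r (p - level_proj n p) = 0" if "r \<in> orth_polys \<mu> n" for r
  proof -
    have "poly_inner \<mu> r (p - level_proj n p) = poly_inner \<mu> (level_proj n r) (p - level_proj n p)"
      using that by (simp add: level_proj_id)
    also have "\<dots> = 0"
      unfolding level_proj_def[of n r] inner_sum_left inner_scale_left inner_M_left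
      by (auto intro!: sum.neutral simp: coef_linear coef_level_proj)
    finally show ?thesis .
  qed
  then show "level_proj n p \<in> orth_polys \<mu> n \<and> (\<forall>r\<in>orth_polys \<mu> n. poly_inner \<mu> r (p - level_proj n p) = 0)"
    by (simp add: level_proj_orth_polys)
qed (use level_proj_unique in blast)

lemma level_proj_other:
  assumes "p \<in> orth_polys \<mu> n" "k \<noteq> n"
  shows "level_proj k p = 0"
proof -
  have "coef m p = 0" if "deg m = k" for m
    using that assms coef_level_proj[of m n p] by (simp add: level_proj_id)
  then show ?thesis by (simp add: level_proj_def)
qed

lemma level_proj_linear:
  "level_proj n 0 = 0"
  "level_proj n (scale c p) = scale c (level_proj n p)"
  "level_proj n (sum f A) = (\<Sum>a\<in>A. level_proj n (f a))"
proof -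
  show "level_proj n 0 = 0"
    by (simp add: level_proj_def coef_linear)
  show "level_proj n (scale c p) = scale c (level_proj n p)"
    by (simp add: level_proj_def coef_linear scale.scale_sum_right)
  show "level_proj n (sum f A) = (\<Sum>a\<in>A. level_proj n (f a))"
    unfolding level_proj_def coef_linear scale.scale_sum_left by (rule sum.swap)
qed

lemma level_proj_M: "level_proj n (M m) = (if deg m = n then M m else 0)"
  using level_proj_id level_proj_other M_orth_polys by metis

subsection \<open>Creation and preservation operators\<close>

text \<open>The three-term recurrence without a middle term: multiplication by a linear form has a part of
  degree one higher and a part of degree one lower only.\<close>

lemma level_proj_X_vec_M:
  assumes "deg m = n"
  shows "level_proj k (X_vec v * M m) =
    (if k = Suc n then \<Sum>j\<in>UNIV. scale (v $ j) (M (inc j m))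
     else if Suc k = n then \<Sum>j\<in>UNIV. scale (v $ j * \<omega> m j) (M (dec j m)) else 0)"
proof -
  have "level_proj k (scale (\<omega> m j) (M (dec j m))) =
      (if Suc k = n then scale (\<omega> m j) (M (dec j m)) else 0)" for j
    using deg_dec[of m j] \<omega>_0[of m j] assms
    by (cases "m j = 0") (auto simp: level_proj_linear level_proj_M)
  moreover have "X_vec v * M m = (\<Sum>j\<in>UNIV. scale (v $ j) (M (inc j m)))
      + (\<Sum>j\<in>UNIV. scale (v $ j) (scale (\<omega> m j) (M (dec j m))))"
    by (simp add: X_vec_eq sum_distrib_right scale_mult_left var_M scale.scale_right_distrib sum.distrib)
  moreover have "level_proj k (p + q) = level_proj k p + level_proj k q" for p q
    by (simp add: level_proj_def coef_linear scale.scale_left_distrib sum.distrib)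
  ultimately have "level_proj k (X_vec v * M m) = (\<Sum>j\<in>UNIV. scale (v $ j) (level_proj k (M (inc j m))))
      + (\<Sum>j\<in>UNIV. scale (v $ j) (if Suc k = n then scale (\<omega> m j) (M (dec j m)) else 0))"
    by (simp only: level_proj_linear(2,3))
  then show ?thesis using assms
    by (auto simp: level_proj_M intro!: sum.cong)
qed

lemma level_proj_X_vec:
  assumes "p \<in> orth_polys \<mu> n"
  shows "level_proj k (X_vec v * p) = (\<Sum>m | deg m = n. scale (coef m p) (level_proj k (X_vec v * M m)))"
  by (subst level_proj_id[OF assms, symmetric])
     (simp add: level_proj_def[of n] sum_distrib_left scale_mult_right level_proj_linear)

lemma a_zero_eq_0: "a_zero \<mu> n v p = 0"
  unfolding a_zero_def orth_proj_eq level_proj_X_vec[OF level_proj_orth_polys[of n p]]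
  by (rule sum.neutral) (auto simp: level_proj_X_vec_M)

text \<open>On polynomials of a single level, one term of the series for the creation operator survives.\<close>

lemma a_plus_on_level:
  assumes "p \<in> orth_polys \<mu> n"
  shows "a_plus \<mu> v p = level_proj (Suc n) (X_vec v * p)"
proof -
  have "level_proj (Suc k) (X_vec v * level_proj k p) =
      (if k = n then level_proj (Suc n) (X_vec v * p) else 0)" for k
    using level_proj_id[OF assms] level_proj_other[OF assms, of k] level_proj_linear(1)
    by (cases "k = n") simp_all
  then show ?thesis unfolding a_plus_def orth_proj_eq by simp
qed

lemma a_plus_combination:
  assumes "\<And>a. a \<in> A \<Longrightarrow> deg (m a) = n"
  shows "a_plus \<mu> v (\<Sum>a\<in>A. scale (f a) (M (m a))) =
    (\<Sum>a\<in>A. \<Sum>j\<in>UNIV. scale (f a * v $ j) (M (inc j (m a))))"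
proof -
  have "(\<Sum>a\<in>A. scale (f a) (M (m a))) \<in> orth_polys \<mu> n"
    by (rule orth_polys_combination) (use M_orth_polys assms in metis)
  then have "a_plus \<mu> v (\<Sum>a\<in>A. scale (f a) (M (m a))) =
      (\<Sum>a\<in>A. scale (f a) (level_proj (Suc n) (X_vec v * M (m a))))"
    by (simp add: a_plus_on_level sum_distrib_left scale_mult_right level_proj_linear)
  also have "\<dots> = (\<Sum>a\<in>A. \<Sum>j\<in>UNIV. scale (f a * v $ j) (M (inc j (m a))))"
    by (rule sum.cong) (use assms in \<open>auto simp: level_proj_X_vec_M scale.scale_sum_right\<close>)
  finally show ?thesis .
qed

end

section \<open>Symmetric tensors\<close>

lemma finite_words [simp]: "finite {w :: 'd::finite list. length w = n}"
  using finite_lists_length_eq[of "UNIV :: 'd set" n] by simp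

lemma sum_words_Suc:
  "(\<Sum>w | length w = Suc n. f w) = (\<Sum>w | length w = n. \<Sum>j\<in>UNIV. f (j # w))"
  for f :: "'d::finite list \<Rightarrow> 'b::comm_monoid_add"
proof -
  have "(\<Sum>w | length w = n. \<Sum>j\<in>UNIV. f (j # w)) = (\<Sum>(w, j)\<in>{w. length w = n} \<times> UNIV. f (j # w))"
    by (rule sum.cartesian_product)
  also have "\<dots> = (\<Sum>w | length w = Suc n. f w)"
  proof (rule sum.reindex_bij_witness[of _ "\<lambda>w. (tl w, hd w)" "\<lambda>(w, j). j # w"])
    fix w :: "'d list" assume "w \<in> {w. length w = Suc n}"
    then show "(case (tl w, hd w) of (w, j) \<Rightarrow> j # w) = w" "(tl w, hd w) \<in> {w. length w = n} \<times> UNIV"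
      by (cases w; simp)+
  qed auto
  finally show ?thesis ..
qed

lemma permute_list_inv:
  assumes "\<pi> permutes {..<length w}"
  shows "permute_list \<pi> (permute_list (inv \<pi>) w) = w" "permute_list (inv \<pi>) (permute_list \<pi> w) = w"
  using permute_list_compose[OF assms, of "inv \<pi>"] permute_list_compose[OF permutes_inv[OF assms], of \<pi>]
    permutes_inv_o[OF assms] by simp_all

lemma sum_words_permute:
  fixes f :: "'d::finite list \<Rightarrow> 'b::comm_monoid_add"
  assumes "\<pi> permutes {..<n}"
  shows "(\<Sum>w | length w = n. f (permute_list \<pi> w)) = (\<Sum>w | length w = n. f w)"
  by (rule sum.reindex_bij_witness[of _ "permute_list (inv \<pi>)" "permute_list \<pi>"])
     (use assms in \<open>auto simp: permute_list_inv\<close>)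

lemma count_list_permute:
  assumes "\<pi> permutes {..<length w}"
  shows "count_list (permute_list \<pi> w) = count_list w"
  using mset_permute_list[OF assms] by (intro ext) (metis count_mset)

lemma count_list_eq_permute:
  assumes "count_list v = count_list w"
  obtains \<pi> where "\<pi> permutes {..<length w}" "permute_list \<pi> w = v"
proof -
  have "mset v = mset w" using assms by (intro multiset_eqI) (simp add: count_mset)
  then show ?thesis using that mset_eq_permutation by metis
qed

lemma sum_count_list: "sum (count_list w) UNIV = length w" for w :: "'d::finite list"
  by (rule sum_count_set) auto

lemma count_list_eq_imp_length_eq:
  "count_list v = count_list w \<Longrightarrow> length v = length w" for v w :: "'d::finite list"
  by (metis sum_count_list)

lemma sym_tensors_add: "s \<in> sym_tensors n \<Longrightarrow> t \<in> sym_tensors n \<Longrightarrow> s + t \<in> sym_tensors n"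
  unfolding sym_tensors_def by (auto simp: lookup_add in_keys_iff)

lemma sym_tensors_scale: "t \<in> sym_tensors n \<Longrightarrow> scale c t \<in> sym_tensors n"
  unfolding sym_tensors_def by (auto simp: in_keys_iff)

lemma sym_tensors_0 [simp]: "0 \<in> sym_tensors n"
  by (simp add: sym_tensors_def)

lemma sym_tensors_sum: "(\<And>a. a \<in> A \<Longrightarrow> f a \<in> sym_tensors n) \<Longrightarrow> sum f A \<in> sym_tensors n"
  by (induction A rule: infinite_finite_induct) (auto intro: sym_tensors_add)

lemma sym_tensors_lookup_outside: "t \<in> sym_tensors n \<Longrightarrow> length w \<noteq> n \<Longrightarrow> Poly_Mapping.lookup t w = 0"
  by (auto simp: sym_tensors_def in_keys_iff)

lemma sym_tensors_lookup_permute: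
  "t \<in> sym_tensors n \<Longrightarrow> length w = n \<Longrightarrow> \<pi> permutes {..<n} \<Longrightarrow>
    Poly_Mapping.lookup t (permute_list \<pi> w) = Poly_Mapping.lookup t w"
  by (simp add: sym_tensors_def)

lemma sym_tensors_lookup_cong:
  assumes "t \<in> sym_tensors n" "count_list v = count_list w"
  shows "Poly_Mapping.lookup t v = Poly_Mapping.lookup t w"
proof (cases "length w = n")
  case True
  then show ?thesis
    using assms count_list_eq_permute[OF assms(2)] sym_tensors_lookup_permute[OF assms(1)] by metis
next
  case False
  then show ?thesis
    using assms count_list_eq_imp_length_eq[OF assms(2)] by (simp add: sym_tensors_lookup_outside)
qed

text \<open>Two words are rearrangements of each other exactly if their letter counts agree; hence coordinates
  that depend on the counts alone are those of a symmetric tensor.\<close>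

lemma sym_tensors_by_counts:
  "(\<Sum>w | length w = n. Poly_Mapping.single w (f (count_list w))) \<in> sym_tensors n"
proof -
  have "Poly_Mapping.lookup (\<Sum>w | length w = n. Poly_Mapping.single w (f (count_list w))) v =
      (if length v = n then f (count_list v) else 0)" for v
    by (simp add: lookup_sum lookup_single when_def sum.delta cong: if_cong)
  then show ?thesis
    by (auto simp: sym_tensors_def in_keys_iff count_list_permute split: if_splits)
qed

lemma clinear_on_combination:
  assumes U: "clinear_on (sym_tensors n) U" and "finite A" "\<And>a. a \<in> A \<Longrightarrow> t a \<in> sym_tensors n"
  shows "U (\<Sum>a\<in>A. scale (c a) (t a)) = (\<Sum>a\<in>A. scale (c a) (U (t a)))"
  using assms(2,3)
proof (induction A rule: finite_induct)
  case empty
  have "U (scale 0 0) = scale 0 (U 0)" using U sym_tensors_0 unfolding clinear_on_def by blast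
  then show ?case by simp
next
  case (insert x F)
  have "scale (c x) (t x) \<in> sym_tensors n" "(\<Sum>a\<in>F. scale (c a) (t a)) \<in> sym_tensors n"
    using insert by (auto intro!: sym_tensors_sum sym_tensors_scale)
  then show ?case using insert U unfolding clinear_on_def by simp
qed

lemma lookup_tensor_prod:
  "Poly_Mapping.lookup (tensor_prod vs) w =
    (if length w = length vs then \<Prod>k<length vs. vs ! k $ w ! k else 0)"
  by (simp add: tensor_prod_def lookup_sum lookup_single when_def sum.delta cong: if_cong)

lemma lookup_tensor_prod_permute:
  assumes "\<pi> permutes {..<length vs}"
  shows "Poly_Mapping.lookup (tensor_prod (permute_list \<pi> vs)) (permute_list \<pi> w) =
    Poly_Mapping.lookup (tensor_prod vs) w"
proof (cases "length w = length vs")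
  case True
  have "(\<Prod>k<length vs. vs ! k $ w ! k) = (\<Prod>k<length vs. vs ! \<pi> k $ w ! \<pi> k)"
    using prod.permute[OF assms, of "\<lambda>k. vs ! k $ w ! k"] by (simp add: o_def)
  then show ?thesis using True assms by (simp add: lookup_tensor_prod permute_list_nth)
qed (simp add: lookup_tensor_prod)

lemma sym_prod_permute:
  assumes "\<sigma> permutes {..<length vs}"
  shows "sym_prod (permute_list \<sigma> vs) = sym_prod vs"
  unfolding sym_prod_def length_permute_list
  by (subst (2) setum_permutations_compose_left[OF assms])
     (auto intro!: arg_cong[of _ _ "scale _"] sum.cong simp: permute_list_compose)

lemma sym_prod_in_sym_tensors: "sym_prod vs \<in> sym_tensors (length vs)"
proof -
  have "Poly_Mapping.lookup (sym_prod vs) (permute_list \<sigma> w) = Poly_Mapping.lookup (sym_prod vs) w"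
    if \<sigma>: "\<sigma> permutes {..<length vs}" for \<sigma> w
  proof -
    let ?P = "{\<pi>. \<pi> permutes {..<length vs}}"
    have "(\<Sum>\<pi>\<in>?P. Poly_Mapping.lookup (tensor_prod (permute_list \<pi> vs)) (permute_list \<sigma> w)) =
        (\<Sum>\<pi>\<in>?P. Poly_Mapping.lookup (tensor_prod (permute_list (\<pi> \<circ> \<sigma>) vs)) (permute_list \<sigma> w))"
      by (rule sum_permutations_compose_right[OF \<sigma>])
    also have "\<dots> = (\<Sum>\<pi>\<in>?P. Poly_Mapping.lookup (tensor_prod (permute_list \<pi> vs)) w)"
      by (rule sum.cong) (use \<sigma> in \<open>auto simp: permute_list_compose lookup_tensor_prod_permute\<close>)
    finally show ?thesis by (simp add: sym_prod_def lookup_sum)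
  qed
  moreover have "Poly_Mapping.lookup (sym_prod vs) w = 0" if "length w \<noteq> length vs" for w
    using that by (simp add: sym_prod_def lookup_sum lookup_tensor_prod)
  ultimately show ?thesis by (auto simp: sym_tensors_def in_keys_iff)
qed

text \<open>The basis vector of the class of \<open>w\<close>, given through a representative.\<close>

definition basis_prod :: "'d list \<Rightarrow> ('d::finite) tensor"
  where "basis_prod w = sym_prod (map (\<lambda>l. axis l 1) w)"

lemma basis_prod_in_sym_tensors: "basis_prod w \<in> sym_tensors (length w)"
  using sym_prod_in_sym_tensors[of "map (\<lambda>l. axis l 1) w"] by (simp add: basis_prod_def)

lemma tensor_prod_axis: "tensor_prod (map (\<lambda>l. axis l 1) w) = Poly_Mapping.single w 1"
proof (rule poly_mapping_eqI)
  fix u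
  have "(\<Prod>k<length w. axis (w ! k) (1::complex) $ u ! k) = (if u = w then 1 else 0)" if len: "length u = length w"
  proof (cases "u = w")
    case False
    then obtain k where "k < length w" "u ! k \<noteq> w ! k" using len nth_equalityI by metis
    then show ?thesis using False by (auto simp: axis_def intro!: prod_zero)
  qed (simp add: axis_def)
  then show "Poly_Mapping.lookup (tensor_prod (map (\<lambda>l. axis l 1) w)) u =
      Poly_Mapping.lookup (Poly_Mapping.single w 1) u"
    by (auto simp: lookup_tensor_prod lookup_single when_def)
qed

lemma basis_prod_eq:
  "basis_prod w = scale (1 / fact (length w))
    (\<Sum>\<pi> | \<pi> permutes {..<length w}. Poly_Mapping.single (permute_list \<pi> w) 1)"
  unfolding basis_prod_def sym_prod_def length_map
  by (intro arg_cong[of _ _ "scale _"] sum.cong) (auto simp: permute_list_map tensor_prod_axis)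

text \<open>Symmetrization fixes a symmetric tensor. Applied to its expansion in elementary tensors, it yields
  an expansion in symmetric products; this is why a linear map on symmetric tensors is determined by
  its values on the symmetric products of basis vectors.\<close>

lemma sym_tensors_expansion:
  assumes t: "t \<in> sym_tensors n"
  shows "t = (\<Sum>w | length w = n. scale (Poly_Mapping.lookup t w) (basis_prod w))"
proof (rule poly_mapping_eqI)
  fix u
  show "Poly_Mapping.lookup t u =
    Poly_Mapping.lookup (\<Sum>w | length w = n. scale (Poly_Mapping.lookup t w) (basis_prod w)) u"
  proof (cases "length u = n")
    case True
    let ?W = "{w :: 'a list. length w = n}" and ?P = "{\<pi>. \<pi> permutes {..<n}}"
    have P: "card ?P = fact n" "finite ?P"
      by (auto simp: card_permutations finite_permutations)
    have "Poly_Mapping.lookup (\<Sum>w\<in>?W. scale (Poly_Mapping.lookup t w) (basis_prod w)) u =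
        (\<Sum>w\<in>?W. \<Sum>\<pi>\<in>?P. 1 / fact n * (Poly_Mapping.lookup t w when permute_list \<pi> w = u))"
      by (auto simp: lookup_sum basis_prod_eq lookup_single sum_distrib_left when_def intro!: sum.cong)
    also have "\<dots> = (\<Sum>\<pi>\<in>?P. \<Sum>w\<in>?W. 1 / fact n * (Poly_Mapping.lookup t (permute_list \<pi> w) when permute_list \<pi> w = u))"
      by (subst sum.swap) (auto simp: sym_tensors_lookup_permute[OF t] intro!: sum.cong)
    also have "\<dots> = (\<Sum>\<pi>\<in>?P. \<Sum>w\<in>?W. 1 / fact n * (Poly_Mapping.lookup t w when w = u))"
      by (intro sum.cong refl sum_words_permute) auto
    also have "\<dots> = (\<Sum>\<pi>\<in>?P. 1 / fact n * Poly_Mapping.lookup t u)"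
      using True by (simp add: when_def if_distrib[of "\<lambda>x. _ * x"] sum.delta cong: if_cong)
    also have "\<dots> = Poly_Mapping.lookup t u"
      using P by simp
    finally show ?thesis ..
  next
    case False
    then have "Poly_Mapping.lookup (basis_prod w) u = 0" if "length w = n" for w
      using that basis_prod_in_sym_tensors[of w] by (simp add: sym_tensors_lookup_outside)
    then show ?thesis
      using False t by (simp add: lookup_sum sym_tensors_lookup_outside)
  qed
qed

lemma mem_cl_iff: "j \<in> cl i \<longleftrightarrow> count_list j = count_list i" for i j :: "'d::finite list"
  using count_list_eq_imp_length_eq by (auto simp: cl_def)

lemma cl_eq_iff: "cl i = cl j \<longleftrightarrow> count_list i = count_list j" for i j :: "'d::finite list"
proof
  assume "cl i = cl j"
  moreover have "i \<in> cl i" by (simp add: mem_cl_iff)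
  ultimately show "count_list i = count_list j" by (simp add: mem_cl_iff)
qed (auto simp: mem_cl_iff)

lemma e_class_cl: "e_class (cl i) = basis_prod i"
proof -
  have "basis_prod j = basis_prod i" if "j \<in> cl i" for j
  proof -
    have "count_list j = count_list i" using that by (simp add: mem_cl_iff)
    then obtain \<pi> where "\<pi> permutes {..<length i}" "permute_list \<pi> i = j"
      by (rule count_list_eq_permute)
    then show ?thesis
      using sym_prod_permute[of \<pi> "map (\<lambda>l. axis l 1) i"] by (auto simp: basis_prod_def permute_list_map)
  qed
  then have "(\<exists>j\<in>cl i. t = basis_prod j) \<longleftrightarrow> t = basis_prod i" for t
    using mem_cl_iff[of i i] by metis
  then show ?thesis
    unfolding e_class_def basis_prod_def[symmetric] by simp
qed

lemma deg_count_list [simp]: "deg (count_list w) = length w"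
  by (simp add: deg_def sum_count_list)

lemma count_list_Cons: "count_list (j # w) = inc j (count_list w)"
  by (auto simp: inc_def)

lemma ex_count_list: "\<exists>w. count_list w = m" for m :: "'d::finite \<Rightarrow> nat"
proof (induction "deg m" arbitrary: m)
  case 0
  then have "m = (\<lambda>_. 0)" by (auto simp: deg_def)
  then show ?case by (intro exI[of _ "[]"]) auto
next
  case (Suc n)
  then have "deg m \<noteq> 0" by simp
  then obtain j where j: "0 < m j" unfolding deg_def by auto
  then have "n = deg (dec j m)" using Suc.hyps(2) deg_dec[of m j] by simp
  then obtain w where "count_list w = dec j m" using Suc.hyps(1) by blast
  then have "count_list (j # w) = m" unfolding count_list_Cons using j by simp
  then show ?case by blast
qed

section \<open>The Jacobi sequences of a recurrent basis\<close>

context recurrent_basis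
begin

text \<open>The elementary tensor of a word goes to the basis polynomial of its letter counts. This is a
  witness for the map which \<open>U_iso\<close> selects by choice.\<close>

definition sym_iso :: "nat \<Rightarrow> 'd tensor \<Rightarrow> 'd cpoly"
  where "sym_iso n t = (\<Sum>w | length w = n. scale (Poly_Mapping.lookup t w) (M (count_list w)))"

text \<open>A symmetric tensor carries the same coordinate on all rearrangements of a word, and \<open>sym_iso\<close> adds
  them up; this is the resulting multiplicity.\<close>

definition arrangements :: "'d list \<Rightarrow> nat"
  where "arrangements w = card {v. count_list v = count_list w}"

lemma arrangements_pos: "0 < arrangements w"
proof -
  have "finite {v. count_list v = count_list w}"
    by (rule finite_subset[OF _ finite_words[of "length w"]]) (auto dest: count_list_eq_imp_length_eq)
  then show ?thesis unfolding arrangements_def by (subst card_gt_0_iff) auto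
qed

lemma sym_iso_orth_polys: "sym_iso n t \<in> orth_polys \<mu> n"
  unfolding sym_iso_def proof (rule orth_polys_combination)
  fix w :: "'d list" assume "w \<in> {w. length w = n}"
  then show "M (count_list w) \<in> orth_polys \<mu> n"
    using M_orth_polys[of "count_list w"] by simp
qed

lemma sym_iso_add: "sym_iso n (s + t) = sym_iso n s + sym_iso n t"
  by (simp add: sym_iso_def lookup_add scale.scale_left_distrib sum.distrib)

lemma sym_iso_scale: "sym_iso n (scale c t) = scale c (sym_iso n t)"
  by (simp add: sym_iso_def scale.scale_sum_right)

lemma sym_iso_sum: "sym_iso n (sum f A) = (\<Sum>a\<in>A. sym_iso n (f a))"
  by (induction A rule: infinite_finite_induct) (simp_all add: sym_iso_add, simp_all add: sym_iso_def)

lemma coef_sym_iso: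
  assumes "t \<in> sym_tensors n" "length w = n"
  shows "coef (count_list w) (sym_iso n t) = of_nat (arrangements w) * Poly_Mapping.lookup t w"
proof -
  have "coef (count_list w) (sym_iso n t) =
      (\<Sum>v | length v = n. if count_list v = count_list w then Poly_Mapping.lookup t w else 0)"
    unfolding sym_iso_def coef_linear coef_M
  proof (rule sum.cong)
    fix v :: "'d list"
    show "Poly_Mapping.lookup t v * (if count_list w = count_list v then 1 else 0) =
        (if count_list v = count_list w then Poly_Mapping.lookup t w else 0)"
      using sym_tensors_lookup_cong[OF assms(1), of v w] by simp
  qed simp
  also have "\<dots> = (\<Sum>v | count_list v = count_list w. Poly_Mapping.lookup t w)"
    by (rule sum.mono_neutral_cong_right) (use assms count_list_eq_imp_length_eq in auto)
  finally show ?thesis by (simp add: arrangements_def)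
qed

text \<open>Creation operators act on the basis by raising indices, so a product of them applied to 1 expands
  over all words exactly as an elementary tensor does.\<close>

lemma foldr_a_plus: "foldr (a_plus \<mu>) vs 1 = sym_iso (length vs) (tensor_prod vs)"
proof (induction vs)
  case Nil
  have "{w :: 'd list. length w = 0} = {[]}" "count_list [] = (\<lambda>_ :: 'd. 0)" by auto
  then show ?case by (simp add: sym_iso_def lookup_tensor_prod M_0)
next
  case (Cons v vs)
  let ?c = "\<lambda>w. \<Prod>k<length vs. vs ! k $ w ! k"
  have "foldr (a_plus \<mu>) (v # vs) 1 =
      a_plus \<mu> v (\<Sum>w | length w = length vs. scale (?c w) (M (count_list w)))"
    by (simp add: Cons.IH sym_iso_def lookup_tensor_prod)
  also have "\<dots> = (\<Sum>w | length w = length vs. \<Sum>j\<in>UNIV.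
      scale (?c w * v $ j) (M (inc j (count_list w))))"
    by (rule a_plus_combination[of _ _ "length vs"]) auto
  also have "\<dots> = sym_iso (length (v # vs)) (tensor_prod (v # vs))"
    unfolding sym_iso_def length_Cons sum_words_Suc
    by (intro sum.cong refl)
       (simp add: lookup_tensor_prod count_list_Cons prod.lessThan_Suc_shift mult.commute del: prod.lessThan_Suc)
  finally show ?case .
qed

lemma sym_iso_tensor_prod_permute:
  assumes "\<pi> permutes {..<length vs}"
  shows "sym_iso (length vs) (tensor_prod (permute_list \<pi> vs)) = sym_iso (length vs) (tensor_prod vs)"
  unfolding sym_iso_def
  by (subst sum_words_permute[OF assms, symmetric])
     (use assms in \<open>auto intro!: sum.cong simp: lookup_tensor_prod_permute count_list_permute\<close>)

lemma sym_iso_sym_prod: "sym_iso (length vs) (sym_prod vs) = foldr (a_plus \<mu>) vs 1"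
proof -
  let ?P = "{\<pi>. \<pi> permutes {..<length vs}}"
  have "card ?P = fact (length vs)" by (auto simp: card_permutations)
  then have "(\<Sum>\<pi>\<in>?P. sym_iso (length vs) (tensor_prod vs)) =
      scale (fact (length vs)) (sym_iso (length vs) (tensor_prod vs))"
    unfolding scale.sum_constant_scale by simp
  moreover have "sym_iso (length vs) (sym_prod vs) =
      scale (1 / fact (length vs)) (\<Sum>\<pi>\<in>?P. sym_iso (length vs) (tensor_prod vs))"
    unfolding sym_prod_def sym_iso_scale sym_iso_sum
    by (intro arg_cong[of _ _ "scale _"] sum.cong) (auto simp: sym_iso_tensor_prod_permute)
  ultimately show ?thesis
    by (simp add: foldr_a_plus)
qed

lemma sym_iso_basis_prod: "sym_iso (length w) (basis_prod w) = M (count_list w)"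
  using sym_iso_sym_prod[of "map (\<lambda>l. axis l 1) w"]
  by (simp add: basis_prod_def foldr_a_plus tensor_prod_axis)
     (simp add: sym_iso_def lookup_single when_def if_distrib[of "\<lambda>c. scale c _"] sum.delta cong: if_cong)

lemma clinear_on_sym_iso: "clinear_on S (sym_iso n)"
  by (simp add: clinear_on_def sym_iso_add sym_iso_scale)

text \<open>On both sides an element is determined by one number per vector of letter counts: the common
  coordinate of the words, and the Fourier coefficient. These differ by the nonzero number of
  arrangements.\<close>

lemma bij_betw_sym_iso: "bij_betw (sym_iso n) (sym_tensors n) (orth_polys \<mu> n)"
proof (rule bij_betw_imageI)
  show "inj_on (sym_iso n) (sym_tensors n)"
  proof (intro inj_onI poly_mapping_eqI)
    fix s t w assume st: "s \<in> sym_tensors n" "t \<in> sym_tensors n" "sym_iso n s = sym_iso n t"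
    show "Poly_Mapping.lookup s w = Poly_Mapping.lookup t w"
    proof (cases "length w = n")
      case True
      then have "of_nat (arrangements w) * Poly_Mapping.lookup s w = of_nat (arrangements w) * Poly_Mapping.lookup t w"
        using st coef_sym_iso by metis
      then show ?thesis using arrangements_pos[of w] by simp
    qed (use st in \<open>simp add: sym_tensors_lookup_outside\<close>)
  qed
  show "sym_iso n ` sym_tensors n = orth_polys \<mu> n"
  proof (intro equalityI subsetI)
    fix p assume p: "p \<in> orth_polys \<mu> n"
    let ?f = "\<lambda>m. coef m p / of_nat (card {v. count_list v = m})"
    define t where "t = (\<Sum>w | length w = n. Poly_Mapping.single w (?f (count_list w)))"
    have t: "t \<in> sym_tensors n" unfolding t_def by (rule sym_tensors_by_counts)
    have "p = sym_iso n t"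
    proof (rule orth_polys_eqI[OF p sym_iso_orth_polys])
      fix m :: "'d \<Rightarrow> nat" assume m: "deg m = n"
      obtain w where w: "count_list w = m" using ex_count_list by blast
      then have "length w = n" using m by auto
      then have "Poly_Mapping.lookup t w = ?f m"
        by (simp add: t_def lookup_sum lookup_single when_def sum.delta w cong: if_cong)
      moreover have "card {v. count_list v = m} \<noteq> 0"
        using arrangements_pos[of w] by (simp add: arrangements_def w)
      ultimately show "coef m p = coef m (sym_iso n t)"
        using coef_sym_iso[OF t \<open>length w = n\<close>] by (simp add: w arrangements_def)
    qed
    then show "p \<in> sym_iso n ` sym_tensors n" using t by blast
  qed (use sym_iso_orth_polys in auto)
qed

lemma U_iso_properties:
  "bij_betw (U_iso \<mu> n) (sym_tensors n) (orth_polys \<mu> n)" "clinear_on (sym_tensors n) (U_iso \<mu> n)"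
  "length vs = n \<Longrightarrow> U_iso \<mu> n (sym_prod vs) = foldr (a_plus \<mu>) vs 1"
proof -
  let ?P = "\<lambda>U. bij_betw U (sym_tensors n) (orth_polys \<mu> n) \<and> clinear_on (sym_tensors n) U \<and>
    (\<forall>vs. length vs = n \<longrightarrow> U (sym_prod vs) = foldr (a_plus \<mu>) vs 1)"
  have "?P (sym_iso n)"
    using bij_betw_sym_iso clinear_on_sym_iso sym_iso_sym_prod by auto
  then have "?P (U_iso \<mu> n)" unfolding U_iso_def by (rule someI[of ?P])
  then show "bij_betw (U_iso \<mu> n) (sym_tensors n) (orth_polys \<mu> n)" "clinear_on (sym_tensors n) (U_iso \<mu> n)"
    "length vs = n \<Longrightarrow> U_iso \<mu> n (sym_prod vs) = foldr (a_plus \<mu>) vs 1" by auto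
qed

text \<open>A linear map with the prescribed values on symmetric products is unique on symmetric tensors, so
  the choice in the definition of \<open>U_iso\<close> does not affect its values there.\<close>

lemma U_iso_eq_sym_iso:
  assumes "t \<in> sym_tensors n"
  shows "U_iso \<mu> n t = sym_iso n t"
proof -
  have eq: "U_iso \<mu> n (basis_prod w) = sym_iso n (basis_prod w)" if "length w = n" for w
    using that U_iso_properties(3)[of "map (\<lambda>l. axis l 1) w" n] sym_iso_sym_prod[of "map (\<lambda>l. axis l 1) w"]
    by (simp add: basis_prod_def)
  have mem: "basis_prod w \<in> sym_tensors n" if "w \<in> {w. length w = n}" for w :: "'d list"
    using that basis_prod_in_sym_tensors by auto
  show ?thesis
    by (subst (1 2) sym_tensors_expansion[OF assms],
        subst (1) clinear_on_combination[OF U_iso_properties(2) finite_words mem], assumption,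
        subst (1) clinear_on_combination[OF clinear_on_sym_iso finite_words mem], assumption)
       (use eq in auto)
qed

text \<open>The preservation operator already vanishes before it is transported to tensors.\<close>

theorem alpha_eq_0:
  assumes "\<xi> \<in> sym_tensors n"
  shows "alpha \<mu> n v \<xi> = 0"
proof -
  have "U_iso \<mu> n 0 = 0" by (simp add: U_iso_eq_sym_iso sym_iso_def)
  moreover have "inj_on (U_iso \<mu> n) (sym_tensors n)" using U_iso_properties(1) bij_betw_def by blast
  ultimately show ?thesis
    unfolding alpha_def a_zero_eq_0 by (metis inv_into_f_f sym_tensors_0)
qed

text \<open>The choice in the definition of \<open>Omega\<close> is justified by a diagonal operator: it multiplies the
  coordinate at a word by the squared norm of the basis polynomial of the word, times the number of
  arrangements of the word.\<close>

lemma tensor_inner_Omega: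
  assumes "\<xi> \<in> sym_tensors n" "\<eta> \<in> sym_tensors n"
  shows "tensor_inner n \<xi> (Omega \<mu> n \<eta>) = poly_inner \<mu> (U_iso \<mu> n \<xi>) (U_iso \<mu> n \<eta>)"
proof -
  let ?P = "\<lambda>\<Omega>. \<Omega> ` sym_tensors n \<subseteq> sym_tensors n \<and> clinear_on (sym_tensors n) \<Omega> \<and>
    (\<forall>\<xi>\<in>sym_tensors n. \<forall>\<eta>\<in>sym_tensors n.
      tensor_inner n \<xi> (\<Omega> \<eta>) = poly_inner \<mu> (U_iso \<mu> n \<xi>) (U_iso \<mu> n \<eta>))"
  define \<Omega> :: "'d tensor \<Rightarrow> 'd tensor" where "\<Omega> \<eta> = (\<Sum>w | length w = n. Poly_Mapping.single w
    (complex_of_real (N (count_list w)) * coef (count_list w) (sym_iso n \<eta>)))" for \<eta>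
  have lookup: "Poly_Mapping.lookup (\<Omega> \<eta>) w = (if length w = n
      then complex_of_real (N (count_list w)) * coef (count_list w) (sym_iso n \<eta>) else 0)" for \<eta> w
    by (simp add: \<Omega>_def lookup_sum lookup_single when_def sum.delta cong: if_cong)
  have "?P \<Omega>"
  proof (intro conjI ballI)
    show "\<Omega> ` sym_tensors n \<subseteq> sym_tensors n"
      unfolding \<Omega>_def
      using sym_tensors_by_counts[where f = "\<lambda>m. complex_of_real (N m) * coef m (sym_iso n _)"] by auto
    show "clinear_on (sym_tensors n) \<Omega>"
      unfolding clinear_on_def
      by (auto intro!: poly_mapping_eqI simp: lookup lookup_add sym_iso_add sym_iso_scale coef_linear algebra_simps)
    fix \<xi> \<eta> :: "'d tensor" assume "\<xi> \<in> sym_tensors n" "\<eta> \<in> sym_tensors n"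
    then show "tensor_inner n \<xi> (\<Omega> \<eta>) = poly_inner \<mu> (U_iso \<mu> n \<xi>) (U_iso \<mu> n \<eta>)"
      by (simp add: tensor_inner_def lookup U_iso_eq_sym_iso)
         (simp add: sym_iso_def[of n \<xi>] inner_sum_left inner_scale_left inner_M_left)
  qed
  then have "?P (Omega \<mu> n)" unfolding Omega_def by (rule someI[of ?P])
  then show ?thesis using assms by blast
qed

text \<open>The basis vectors of the tensor space are mapped to the orthogonal basis polynomials themselves.\<close>

theorem Omega_coeff_eq:
  assumes "length i = n" "length j = n"
  shows "Omega_coeff \<mu> n (cl i) (cl j) =
    (if cl i = cl j then complex_of_real (N (count_list i)) else 0)"
proof -
  have "basis_prod i \<in> sym_tensors n" "basis_prod j \<in> sym_tensors n"
    using basis_prod_in_sym_tensors[of i] basis_prod_in_sym_tensors[of j] assms by auto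
  then have "Omega_coeff \<mu> n (cl i) (cl j) =
      poly_inner \<mu> (sym_iso (length i) (basis_prod i)) (sym_iso (length j) (basis_prod j))"
    using assms by (simp add: Omega_coeff_def e_class_cl tensor_inner_Omega U_iso_eq_sym_iso)
  then show ?thesis by (simp add: sym_iso_basis_prod inner_M cl_eq_iff)
qed

end

section \<open>Multiple Legendre polynomials on the cube\<close>

text \<open>Fubini for functions in separated variables, on $\mathbb{R}^d$ with coordinates indexed by a type
  instead of by the set of basis vectors.\<close>

lemma integral_lborel_vec_prod:
  fixes g :: "'d::finite \<Rightarrow> real \<Rightarrow> real"
  assumes g: "\<And>j. integrable lborel (g j)"
  shows "(\<integral>x. (\<Prod>j\<in>UNIV. g j (x $ j)) \<partial>(lborel :: (real ^ 'd) measure)) = (\<Prod>j\<in>UNIV. \<integral>t. g j t \<partial>lborel)"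
proof -
  interpret product_sigma_finite "\<lambda>_ :: real ^ 'd. lborel :: real measure"
    by unfold_locales
  let ?e = "\<lambda>j :: 'd. axis j (1 :: real)"
  define idx where "idx = inv ?e"
  have inj: "inj ?e" by (auto simp: inj_def axis_eq_axis)
  have idx [simp]: "idx (?e j) = j" for j
    unfolding idx_def by (rule inv_f_f[OF inj])
  have Basis: "Basis = range ?e"
    by (auto simp: Basis_vec_def)
  have comp: "(\<Sum>b\<in>Basis. y b *\<^sub>R b) $ j = y (?e j)" for y :: "real ^ 'd \<Rightarrow> real" and j
  proof -
    have "(\<Sum>b\<in>Basis. y b *\<^sub>R b) $ j = (\<Sum>b\<in>Basis. y b *\<^sub>R b) \<bullet> ?e j"
      by (simp add: cart_eq_inner_axis)
    also have "\<dots> = y (?e j)"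
      by (rule inner_sum_left_Basis) (simp add: Basis)
    finally show ?thesis .
  qed
  have [measurable]: "g j \<in> borel_measurable borel" for j
    using borel_measurable_integrable[OF g] by simp
  have "(\<integral>x. (\<Prod>j\<in>UNIV. g j (x $ j)) \<partial>(lborel :: (real ^ 'd) measure)) =
      (\<integral>y. (\<Prod>j\<in>UNIV. g j ((\<Sum>b\<in>Basis. y b *\<^sub>R b) $ j)) \<partial>(\<Pi>\<^sub>M b\<in>(Basis :: (real ^ 'd) set). lborel))"
    by (subst lborel_eq) (rule integral_distr; measurable)
  also have "\<dots> = (\<integral>y. (\<Prod>b\<in>Basis. g (idx b) (y b)) \<partial>(\<Pi>\<^sub>M b\<in>(Basis :: (real ^ 'd) set). lborel))"
    unfolding comp by (simp add: Basis prod.reindex[OF inj])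
  also have "\<dots> = (\<Prod>b\<in>(Basis :: (real ^ 'd) set). \<integral>t. g (idx b) t \<partial>lborel)"
    by (rule product_integral_prod) (auto simp: g)
  also have "\<dots> = (\<Prod>j\<in>UNIV. \<integral>t. g j t \<partial>lborel)"
    by (simp add: Basis prod.reindex[OF inj])
  finally show ?thesis .
qed

abbreviation (input) cube :: "(real ^ 'd::finite) set"
  where "cube \<equiv> cbox (\<chi> k. -1) (\<chi> k. 1)"

lemma integral_cube_poly_prod:
  "(\<integral>x. (\<Prod>j\<in>UNIV. poly (p j) (x $ j)) \<partial>lebesgue_on (cube :: (real ^ 'd::finite) set)) =
   (\<Prod>j\<in>UNIV. moment (p j))"
proof -
  have [measurable]: "poly (p j) \<in> borel_measurable borel" for j
    by (intro borel_measurable_continuous_onI continuous_intros)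
  have "indicator cube x = (\<Prod>j\<in>UNIV. indicator {-1..1::real} (x $ j) :: real)" for x :: "real ^ 'd"
  proof (cases "x \<in> cube")
    case False
    then obtain j where "x $ j \<notin> {-1..1}" by (auto simp: mem_box_cart)
    then have "(\<Prod>j\<in>UNIV. indicator {-1..1::real} (x $ j) :: real) = 0"
      by (intro prod_zero) (auto simp: indicator_def intro!: bexI[of _ j])
    then show ?thesis using False by simp
  qed (simp add: mem_box_cart)
  then have split: "indicator cube x *\<^sub>R (\<Prod>j\<in>UNIV. poly (p j) (x $ j)) =
      (\<Prod>j\<in>UNIV. poly (p j) (x $ j) * indicator {-1..1} (x $ j))" for x :: "real ^ 'd"
    by (simp add: prod.distrib mult.commute)
  have "(\<integral>x. (\<Prod>j\<in>UNIV. poly (p j) (x $ j)) \<partial>lebesgue_on (cube :: (real ^ 'd) set)) =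
      (\<integral>x. indicator cube x *\<^sub>R (\<Prod>j\<in>UNIV. poly (p j) (x $ j)) \<partial>(lebesgue :: (real ^ 'd) measure))"
    by (rule integral_restrict_space) auto
  also have "\<dots> = (\<integral>x. indicator cube x *\<^sub>R (\<Prod>j\<in>UNIV. poly (p j) (x $ j)) \<partial>(lborel :: (real ^ 'd) measure))"
    by (intro integral_completion) measurable
  also have "\<dots> = (\<Prod>j\<in>UNIV. moment (p j))"
    unfolding split moment_def by (rule integral_lborel_vec_prod) (rule integrable_poly_interval)
  finally show ?thesis .
qed

text \<open>$L_n(X_j)$, given by the recurrence rather than by substitution, which makes the product with $X_j$
  immediate.\<close>

fun legendre_in :: "'d \<Rightarrow> nat \<Rightarrow> ('d::finite) cpoly" where
  "legendre_in j 0 = 1"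
| "legendre_in j (Suc 0) = var j"
| "legendre_in j (Suc (Suc n)) = var j * legendre_in j (Suc n)
     - scale (complex_of_real (legendre_coeff (Suc n))) (legendre_in j n)"

lemma var_mult_legendre_in:
  "var j * legendre_in j n = legendre_in j (Suc n)
     + scale (complex_of_real (legendre_coeff n)) (legendre_in j (n - 1))"
  by (cases n) auto

lemma poly_eval_legendre_in:
  "poly_eval (legendre_in j n) x = complex_of_real (poly (legendre n) (x $ j))"
  by (induction j n rule: legendre_in.induct)
     (simp_all add: poly_eval_mult poly_eval_diff poly_eval_scale)

definition multi_legendre :: "('d \<Rightarrow> nat) \<Rightarrow> ('d::finite) cpoly"
  where "multi_legendre m = (\<Prod>j\<in>UNIV. legendre_in j (m j))"

lemma multi_legendre_upd:
  "multi_legendre (m(j := n)) = legendre_in j n * (\<Prod>i\<in>UNIV - {j}. legendre_in i (m i))"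
  unfolding multi_legendre_def by (subst prod.remove[of _ j]) (auto intro!: prod.cong)

lemma poly_inner_multi_legendre:
  "poly_inner (lebesgue_on cube) (multi_legendre m) (multi_legendre m') =
   (if m = m' then complex_of_real (\<Prod>j\<in>UNIV. legendre_norm (m j)) else 0)"
proof -
  have "poly_inner (lebesgue_on cube) (multi_legendre m) (multi_legendre m') =
      (\<integral>x. complex_of_real (\<Prod>j\<in>UNIV. poly (legendre (m j) * legendre (m' j)) (x $ j)) \<partial>lebesgue_on cube)"
    by (simp add: poly_inner_def multi_legendre_def poly_eval_prod poly_eval_legendre_in prod.distrib)
  also have "\<dots> = complex_of_real (\<Prod>j\<in>UNIV. moment (legendre (m j) * legendre (m' j)))"
    by (simp only: integral_complex_of_real integral_cube_poly_prod)
  also have "(\<Prod>j\<in>UNIV. moment (legendre (m j) * legendre (m' j))) =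
      (if m = m' then (\<Prod>j\<in>UNIV. legendre_norm (m j)) else 0)"
    unfolding legendre_orthogonal by (auto simp: fun_eq_iff)
  finally show ?thesis by simp
qed

text \<open>Multiplication by a variable affects a single factor of the product, so the recurrence in one
  variable carries over.\<close>

interpretation cube: recurrent_basis "lebesgue_on (cube :: (real ^ 'd::finite) set)" multi_legendre
  "\<lambda>m. \<Prod>j\<in>UNIV. legendre_norm (m j)" "\<lambda>m j. complex_of_real (legendre_coeff (m j))"
proof
  fix p q :: "'d cpoly"
  show "integrable (lebesgue_on cube) (\<lambda>x. cnj (poly_eval p x) * poly_eval q x)"
    unfolding poly_eval_def by (intro continuous_imp_integrable continuous_intros)
next
  fix m :: "'d \<Rightarrow> nat" and j
  have "m(j := m j) = m" by simp
  then have "multi_legendre m = legendre_in j (m j) * (\<Prod>i\<in>UNIV - {j}. legendre_in i (m i))"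
    by (metis multi_legendre_upd)
  then show "var j * multi_legendre m = multi_legendre (inc j m)
      + scale (complex_of_real (legendre_coeff (m j))) (multi_legendre (dec j m))"
    unfolding inc_def dec_def multi_legendre_upd
    by (simp add: mult.assoc[symmetric] var_mult_legendre_in distrib_right scale_mult_left
        del: legendre_in.simps)
next
  show "multi_legendre (\<lambda>_. 0) = (1 :: 'd cpoly)" by (simp add: multi_legendre_def)
qed (auto simp: poly_inner_multi_legendre legendre_norm_pos intro: prod_pos)

theorem theorem6p5:
  fixes \<mu> :: "(real ^ 'd::finite) measure"
  assumes "\<mu> = lebesgue_on (cbox (\<chi> k. -1) (\<chi> k. 1))"
  shows "(\<forall>n. \<forall>v :: complex ^ 'd. \<forall>\<xi>\<in>sym_tensors n. alpha \<mu> n v \<xi> = 0) \<and>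
    (\<forall>n. \<forall>i j :: 'd list. length i = n \<and> length j = n \<longrightarrow>
      Omega_coeff \<mu> n (cl i) (cl j) = complex_of_real
        ((if cl i = cl j then 1 else 0) *
         (2 ^ CARD('d) / (\<Prod>l\<in>UNIV. fact (count_list i l))) *
         (\<Prod>l\<in>UNIV. (\<Prod>p<count_list i l. (real p + 1) / (2 * real p + 1))\<^sup>2) *
         (\<Prod>l\<in>UNIV. Gamma (real (count_list i l) + 1) / (2 * real (count_list i l) + 1))))"
proof (intro conjI allI ballI impI)
  fix n and v :: "complex ^ 'd" and \<xi> :: "'d tensor" assume "\<xi> \<in> sym_tensors n"
  then show "alpha \<mu> n v \<xi> = 0" unfolding assms by (rule cube.alpha_eq_0)
next
  fix n and i j :: "'d list" assume "length i = n \<and> length j = n"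
  then have coeff: "Omega_coeff \<mu> n (cl i) (cl j) =
      (if cl i = cl j then complex_of_real (\<Prod>l\<in>UNIV. legendre_norm (count_list i l)) else 0)"
    unfolding assms by (intro cube.Omega_coeff_eq) auto
  have Gamma: "Gamma (real k + 1) = fact k" for k
    by (subst add.commute) (rule Gamma_fact)
  let ?Q = "\<lambda>n. (\<Prod>p<n. (real p + 1) / (2 * real p + 1))\<^sup>2"
  have "(2 ^ CARD('d) / (\<Prod>l\<in>UNIV. fact (count_list i l))) * (\<Prod>l\<in>UNIV. ?Q (count_list i l)) *
      (\<Prod>l\<in>UNIV. Gamma (real (count_list i l) + 1) / (2 * real (count_list i l) + 1)) =
      (\<Prod>l\<in>UNIV. 2 / fact (count_list i l) * ?Q (count_list i l) *
        (Gamma (real (count_list i l) + 1) / (2 * real (count_list i l) + 1)))"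
    by (simp only: prod.distrib prod_dividef prod_constant)
  also have "\<dots> = (\<Prod>l\<in>UNIV. legendre_norm (count_list i l))"
    by (intro prod.cong refl) (simp add: legendre_norm_def Gamma)
  finally have formula: "(2 ^ CARD('d) / (\<Prod>l\<in>UNIV. fact (count_list i l))) * (\<Prod>l\<in>UNIV. ?Q (count_list i l)) *
      (\<Prod>l\<in>UNIV. Gamma (real (count_list i l) + 1) / (2 * real (count_list i l) + 1)) =
      (\<Prod>l\<in>UNIV. legendre_norm (count_list i l))" .
  show "Omega_coeff \<mu> n (cl i) (cl j) = complex_of_real
        ((if cl i = cl j then 1 else 0) *
         (2 ^ CARD('d) / (\<Prod>l\<in>UNIV. fact (count_list i l))) *
         (\<Prod>l\<in>UNIV. (\<Prod>p<count_list i l. (real p + 1) / (2 * real p + 1))\<^sup>2) *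
         (\<Prod>l\<in>UNIV. Gamma (real (count_list i l) + 1) / (2 * real (count_list i l) + 1)))"
    unfolding coeff mult.assoc formula[unfolded mult.assoc] by simp
qed

end
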